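(* For any AFSM $(\mathcal F,\mathcal R)$: if there is an infinite $(\mathit{SDP}(\mathcal R),\mathcal R)$-chain $[(\rho_0,s_0,t_0),(\rho_1,s_1,t_1),\dots]$ in which every $\rho_i$ is conservative, then $\to_{\mathcal R}$ is non-terminating.
   Context: Types, terms, substitutions, rules. Fix a set $\mathcal S$ of sorts; types are sorts and $\sigma\to\tau$ ($\to$ right-associative). Fix disjoint sets $\mathcal F$ (function symbols), $\mathcal V$ (variables), $\mathcal M$ (meta-variables), each symbol typed, each meta-variable $Z$ with a natural number $\mathit{arity}(Z)$; $\mathcal V,\mathcal M$ contain infinitely many symbols of every type. Meta-terms: $x:\sigma$ ($x:\sigma\in\mathcal V$); $\mathsf f:\sigma$ ($\mathsf f:\sigma\in\mathcal F$); $s\,t:\tau$ if $s:\sigma\to\tau,t:\sigma$; $\lambda x.s:\sigma\to\tau$ if $x:\sigma\in\mathcal V,s:\tau$; $Z\langle s_1,..,s_k\rangle:\sigma_{k+1}\to\cdots\to\iota$ if $Z:\sigma_1\to\cdots\to\sigma_m\to\iota$ has arity $k$ and $s_i:\sigma_i$ (write $Z$ for $Z\langle\rangle$). Terms are meta-terms without meta-variables. Application left-associative; $\lambda$ binds; modulo $\alpha$; $FV,FMV$ are free variables and meta-variables; closed means no free variables. A pattern is $Z\langle x_1,..,x_k\rangle$ (distinct variables), $\lambda x.\ell$ ($\ell$ a pattern), or $a\,\ell_1\cdots\ell_n$ ($a\in\mathcal F\cup\mathcal V$, $\ell_i$ patterns). Substitutions $\gamma$ map variables and meta-variables type-preservingly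 to meta-terms (to terms for a substitution); the domain consists of $x$ with $\gamma(x)\ne x$ and $Z$ of arity $k$ with $\gamma(Z)\ne\lambda y_1..y_k.Z\langle y_1,..,y_k\rangle$. Application is homomorphic and capture-avoiding, except $Z\langle s_1,..,s_k\rangle\gamma=u[x_1:=s_1\gamma,..,x_n:=s_n\gamma](s_{n+1}\gamma)\cdots(s_k\gamma)$ when $Z\in\mathrm{dom}(\gamma)$ and $\gamma(Z)=\lambda x_1..x_n.u$ with $n=k$, or $n<k$ and $u$ not an abstraction. A rule is a pair $\ell\Rightarrow r$ of closed meta-terms of the same type, $\ell$ a pattern $\mathsf f\,\ell_1\cdots\ell_n$ ($\mathsf f\in\mathcal F$), $FMV(r)\subseteq FMV(\ell)$. $\to_{\mathcal R}$ is the smallest relation on terms closed under all contexts (including under $\lambda$) containing $\ell\delta\to r\delta$ for rules and substitutions with $\mathrm{dom}(\delta)=FMV(\ell)$, and $(\lambda x.s)t\to s[x:=t]$. Defined symbols $\mathcal D$: symbols heading some rule's left-hand side. An AFSM is a pair $(\mathcal F,\mathcal R)$. For each $\mathsf f\in\mathcal D$ a natural number $\mathit{minar}(\mathsf f)$ is fixed (when the AFSM is properly applied, it is the number of arguments of $\mathsf f$ in all left-hand sides; otherwise any fixed choice). Static dependency pairs: $\mathcal F^\sharp=\mathcal F\uplus\{\mathsf f^\sharp:\sigma\mid\mathsf f:\sigma\in\mathcal D\}$; for $s=\mathsf f\,s_1\cdots s_k$ with $\mathsf f\in\mathcal D$, $k=\mathit{minar}(\mathsf f)$, let $s^\sharp=\mathsf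 f^\sharp s_1\cdots s_k$. A dependency pair (DP) is a triple $\ell\Rrightarrow p\ (A)$ with $\ell$ a closed pattern $\mathsf f\,\ell_1\cdots\ell_k$, $p$ a closed meta-term $\mathsf g\,p_1\cdots p_n$, and $A$ a set of meta-variable conditions $Z:i$; it is conservative if $FMV(p)\subseteq FMV(\ell)$. A substitution $\gamma$ respects $A$ if for all $Z:i\in A$, $\gamma(Z)=\lambda x_1..x_j.t$ with $i>j$, or $i\le j$ and $x_i\in FV(t)$. Define $s\trianglerighteq^\beta_A t$ by: $s=t$; or $s=\lambda x.u$ and $u\trianglerighteq^\beta_A t$; or $s=(\lambda x.u)\,s_0\cdots s_n$ and some $s_i\trianglerighteq^\beta_A t$ or $u[x:=s_0]\,s_1\cdots s_n\trianglerighteq^\beta_A t$; or $s=a\,s_1\cdots s_n$ with $a\in\mathcal F\cup\mathcal V$ and some $s_i\trianglerighteq^\beta_A t$; or $s=Z\langle t_1,..,t_e\rangle\,s_1\cdots s_n$ and some $s_i\trianglerighteq^\beta_A t$; or $s=Z\langle t_1,..,t_e\rangle\,s_1\cdots s_n$ and $t_i\trianglerighteq^\beta_A t$ for some $i$ with $(Z:i)\in A$. $\mathsf{cand}(s)$ consists of the pairs $t\ (A)$ with $t=\mathsf f\,s_1\cdots s_k$, $\mathsf f\in\mathcal D$, $k=\mathit{minar}(\mathsf f)$, such that $s\trianglerighteq^\beta_A t\,s_{k+1}\cdots s_n$ for some $s_{k+1},..,s_n$, and no $A'\subsetneq A$ has $s\trianglerighteq^\beta_{A'}t$. $\mathit{metafy}(s)$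 replaces every free variable of $s$ by a corresponding fresh arity-$0$ meta-variable. $\mathit{SDP}(\mathcal R)=\{\ell^\sharp\Rrightarrow\mathit{metafy}(p^\sharp)\ (A)\mid\ell\Rightarrow r\in\mathcal R,\ p\ (A)\in\mathsf{cand}(r)\}$. Chains: a $(\mathcal P,\mathcal R)$-chain (for a set $\mathcal P$ of DPs) is a sequence $[(\ell_0\Rrightarrow p_0\,(A_0),s_0,t_0),\dots]$ with each DP in $\mathcal P$, $s_i,t_i$ terms over $\mathcal F^\sharp$, such that for all $i$: some substitution $\gamma$ with domain $FMV(\ell_i)\cup FMV(p_i)$ respects $A_i$ and has $s_i=\ell_i\gamma$, $t_i=p_i\gamma$; and $t_i=\mathsf f\,u_1\cdots u_n$, $s_{i+1}=\mathsf f\,w_1\cdots w_n$ with each $u_j\to^*_{\mathcal R}w_j$. *)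

theory Defs
  imports Main
begin

datatype 's ty = Sort 's | Fun "'s ty" "'s ty"

fun arg_types :: "'s ty \<Rightarrow> 's ty list" where
  "arg_types (Sort \<iota>) = []"
| "arg_types (Fun \<sigma> \<tau>) = \<sigma> # arg_types \<tau>"

text \<open>
  Meta-terms modulo \<open>\<alpha>\<close> in locally nameless style: free variables are the symbols
  \<open>Free x\<close>, bound ones are de Bruijn indices.  The named abstraction \<open>\<lambda>x. s\<close> is the
  derived operation \<open>lam x s\<close> below, and all later notions are phrased with it.
  The set functions \<open>FV\<close> and \<open>FMV\<close> of the datatype are the free variables and the
  meta-variables of a meta-term.
\<close>

datatype (funs: 'f, FV: 'v, FMV: 'm, sorts: 's) mterm =
    Free 'v
  | Bnd nat
  | Fn 'f
  | App "('f, 'v, 'm, 's) mterm" "('f, 'v, 'm, 's) mterm"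
  | Abs "'s ty" "('f, 'v, 'm, 's) mterm"
  | Meta 'm "('f, 'v, 'm, 's) mterm list"

abbreviation apps :: "('f, 'v, 'm, 's) mterm \<Rightarrow> ('f, 'v, 'm, 's) mterm list \<Rightarrow> ('f, 'v, 'm, 's) mterm" where
  "apps \<equiv> foldl App"

fun is_abs :: "('f, 'v, 'm, 's) mterm \<Rightarrow> bool" where
  "is_abs (Abs \<sigma> t) = True"
| "is_abs t = False"

fun shift :: "nat \<Rightarrow> nat \<Rightarrow> ('f, 'v, 'm, 's) mterm \<Rightarrow> ('f, 'v, 'm, 's) mterm" where
  "shift d c (Free x) = Free x"
| "shift d c (Bnd i) = (if i < c then Bnd i else Bnd (i + d))"
| "shift d c (Fn f) = Fn f"
| "shift d c (App s t) = App (shift d c s) (shift d c t)"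
| "shift d c (Abs \<sigma> t) = Abs \<sigma> (shift d (Suc c) t)"
| "shift d c (Meta Z ts) = Meta Z (map (shift d c) ts)"

text \<open>
  \<open>inst c ss t\<close> removes the \<open>length ss\<close> binders at level \<open>c\<close>, simultaneously replacing
  the index \<open>c + i\<close> by \<open>ss ! i\<close>.
\<close>

fun inst :: "nat \<Rightarrow> ('f, 'v, 'm, 's) mterm list \<Rightarrow> ('f, 'v, 'm, 's) mterm \<Rightarrow> ('f, 'v, 'm, 's) mterm" where
  "inst c ss (Free x) = Free x"
| "inst c ss (Bnd i) =
    (if i < c then Bnd i
     else if i - c < length ss then shift c 0 (ss ! (i - c))
     else Bnd (i - length ss))"
| "inst c ss (Fn f) = Fn f"
| "inst c ss (App s t) = App (inst c ss s) (inst c ss t)"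
| "inst c ss (Abs \<sigma> t) = Abs \<sigma> (inst (Suc c) ss t)"
| "inst c ss (Meta Z ts) = Meta Z (map (inst c ss) ts)"

fun bind :: "nat \<Rightarrow> 'v \<Rightarrow> ('f, 'v, 'm, 's) mterm \<Rightarrow> ('f, 'v, 'm, 's) mterm" where
  "bind c x (Free y) = (if y = x then Bnd c else Free y)"
| "bind c x (Bnd i) = (if i < c then Bnd i else Bnd (Suc i))"
| "bind c x (Fn f) = Fn f"
| "bind c x (App s t) = App (bind c x s) (bind c x t)"
| "bind c x (Abs \<sigma> t) = Abs \<sigma> (bind (Suc c) x t)"
| "bind c x (Meta Z ts) = Meta Z (map (bind c x) ts)"

text \<open>
  \<open>strip_abs k t = (n, u)\<close> writes \<open>t\<close> as \<open>n\<close> abstractions over \<open>u\<close>, where \<open>n = k\<close>, or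
  \<open>n < k\<close> and \<open>u\<close> is not an abstraction.
\<close>

fun strip_abs :: "nat \<Rightarrow> ('f, 'v, 'm, 's) mterm \<Rightarrow> nat \<times> ('f, 'v, 'm, 's) mterm" where
  "strip_abs (Suc k) (Abs \<sigma> t) = (case strip_abs k t of (n, u) \<Rightarrow> (Suc n, u))"
| "strip_abs k t = (0, t)"

text \<open>
  \<open>meta_app (\<lambda>x\<^sub>1\<dots>x\<^sub>n. u) [s\<^sub>1,\<dots>,s\<^sub>k] = u[x\<^sub>1 := s\<^sub>1,\<dots>,x\<^sub>n := s\<^sub>n] s\<^sub>n\<^sub>+\<^sub>1 \<dots> s\<^sub>k\<close>; the list is
  reversed because index \<open>0\<close> is the innermost binder \<open>x\<^sub>n\<close>.
\<close>

definition meta_app :: "('f, 'v, 'm, 's) mterm \<Rightarrow> ('f, 'v, 'm, 's) mterm list \<Rightarrow> ('f, 'v, 'm, 's) mterm" where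
  "meta_app t ss =
    (case strip_abs (length ss) t of (n, u) \<Rightarrow> apps (inst 0 (rev (take n ss)) u) (drop n ss))"

type_synonym ('f, 'v, 'm, 's) subst = "'v + 'm \<Rightarrow> ('f, 'v, 'm, 's) mterm"

type_synonym ('f, 'v, 'm, 's) rule = "('f, 'v, 'm, 's) mterm \<times> ('f, 'v, 'm, 's) mterm"

type_synonym ('f, 'v, 'm, 's) dp =
  "('f, 'v, 'm, 's) mterm \<times> ('f, 'v, 'm, 's) mterm \<times> ('m \<times> nat) set"

definition defined_symbols :: "('f, 'v, 'm, 's) rule set \<Rightarrow> 'f set" where
  "defined_symbols R = {f. \<exists>ls r. (apps (Fn f) ls, r) \<in> R}"

definition conservative :: "('f, 'v, 'm, 's) dp \<Rightarrow> bool" where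
  "conservative \<rho> = (case \<rho> of (l, p, A) \<Rightarrow> FMV p \<subseteq> FMV l)"

text \<open>
  A set of typed function symbols is a partial map from names to types.
\<close>

type_synonym ('f, 's) sig = "'f \<Rightarrow> 's ty option"

datatype 'f marked = Plain 'f | Sharp 'f

fun sharp_sig :: "('f, 's) sig \<Rightarrow> ('f, 'v, 'm, 's) rule set \<Rightarrow> ('f marked, 's) sig" where
  "sharp_sig F R (Plain f) = F f"
| "sharp_sig F R (Sharp f) = (if f \<in> defined_symbols R then F f else None)"

definition plain :: "('f, 'v, 'm, 's) mterm \<Rightarrow> ('f marked, 'v, 'm, 's) mterm" where
  "plain = map_mterm Plain id id id"

definition plain_rules :: "('f, 'v, 'm, 's) rule set \<Rightarrow> ('f marked, 'v, 'm, 's) rule set" where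
  "plain_rules R = {(plain l, plain r) | l r. (l, r) \<in> R}"

locale symbols =
  fixes vty :: "'v \<Rightarrow> 's ty"
    and mty :: "'m \<Rightarrow> 's ty"
    and arity :: "'m \<Rightarrow> nat"
  assumes infinite_vars: "infinite {x. vty x = \<sigma>}"
    and infinite_mvars: "infinite {Z. mty Z = \<sigma>}"
    and arity_le: "arity Z \<le> length (arg_types (mty Z))"
begin

inductive has_type :: "('f, 's) sig \<Rightarrow> 's ty list \<Rightarrow> ('f, 'v, 'm, 's) mterm \<Rightarrow> 's ty \<Rightarrow> bool"
  for F :: "('f, 's) sig" where
  "has_type F \<Gamma> (Free x) (vty x)"
| "i < length \<Gamma> \<Longrightarrow> has_type F \<Gamma> (Bnd i) (\<Gamma> ! i)"
| "F f = Some \<sigma> \<Longrightarrow> has_type F \<Gamma> (Fn f) \<sigma>"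
| "has_type F \<Gamma> s (Fun \<sigma> \<tau>) \<Longrightarrow> has_type F \<Gamma> t \<sigma> \<Longrightarrow> has_type F \<Gamma> (App s t) \<tau>"
| "has_type F (\<sigma> # \<Gamma>) s \<tau> \<Longrightarrow> has_type F \<Gamma> (Abs \<sigma> s) (Fun \<sigma> \<tau>)"
| "length ss = arity Z \<Longrightarrow> mty Z = foldr Fun \<sigma>s \<tau> \<Longrightarrow> list_all2 (has_type F \<Gamma>) ss \<sigma>s
    \<Longrightarrow> has_type F \<Gamma> (Meta Z ss) \<tau>"

definition is_mterm :: "('f, 's) sig \<Rightarrow> ('f, 'v, 'm, 's) mterm \<Rightarrow> bool" where
  "is_mterm F s \<longleftrightarrow> (\<exists>\<sigma>. has_type F [] s \<sigma>)"

definition is_term :: "('f, 's) sig \<Rightarrow> ('f, 'v, 'm, 's) mterm \<Rightarrow> bool" where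
  "is_term F s \<longleftrightarrow> is_mterm F s \<and> FMV s = {}"

definition lam :: "'v \<Rightarrow> ('f, 'v, 'm, 's) mterm \<Rightarrow> ('f, 'v, 'm, 's) mterm" where
  "lam x s = Abs (vty x) (bind 0 x s)"

definition lams :: "'v list \<Rightarrow> ('f, 'v, 'm, 's) mterm \<Rightarrow> ('f, 'v, 'm, 's) mterm" where
  "lams xs s = foldr lam xs s"

inductive pattern :: "('f, 'v, 'm, 's) mterm \<Rightarrow> bool" where
  "distinct xs \<Longrightarrow> pattern (Meta Z (map Free xs))"
| "pattern l \<Longrightarrow> pattern (lam x l)"
| "(\<And>l. l \<in> set ls \<Longrightarrow> pattern l) \<Longrightarrow> pattern (apps (Fn f) ls)"
| "(\<And>l. l \<in> set ls \<Longrightarrow> pattern l) \<Longrightarrow> pattern (apps (Free x) ls)"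

text \<open>\<open>meta_id Z\<close> is \<open>\<lambda>y\<^sub>1\<dots>y\<^sub>k. Z\<langle>y\<^sub>1,\<dots>,y\<^sub>k\<rangle>\<close> for \<open>k = arity Z\<close>.\<close>

definition meta_id :: "'m \<Rightarrow> ('f, 'v, 'm, 's) mterm" where
  "meta_id Z = foldr Abs (take (arity Z) (arg_types (mty Z))) (Meta Z (map Bnd (rev [0..<arity Z])))"

definition sdom :: "('f, 'v, 'm, 's) subst \<Rightarrow> ('v + 'm) set" where
  "sdom \<gamma> = {Inl x | x. \<gamma> (Inl x) \<noteq> Free x} \<union> {Inr Z | Z. \<gamma> (Inr Z) \<noteq> meta_id Z}"

definition is_subst :: "('f, 's) sig \<Rightarrow> ('f, 'v, 'm, 's) subst \<Rightarrow> bool" where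
  "is_subst F \<gamma> \<longleftrightarrow>
    (\<forall>x. has_type F [] (\<gamma> (Inl x)) (vty x)) \<and>
    (\<forall>Z. has_type F [] (\<gamma> (Inr Z)) (mty Z)) \<and>
    (\<forall>a\<in>sdom \<gamma>. is_term F (\<gamma> a))"

text \<open>
  No shifting is needed below \<open>Abs\<close>: the values of a substitution have no dangling indices.
\<close>

fun subst :: "('f, 'v, 'm, 's) subst \<Rightarrow> ('f, 'v, 'm, 's) mterm \<Rightarrow> ('f, 'v, 'm, 's) mterm" where
  "subst \<gamma> (Free x) = \<gamma> (Inl x)"
| "subst \<gamma> (Bnd i) = Bnd i"
| "subst \<gamma> (Fn f) = Fn f"
| "subst \<gamma> (App s t) = App (subst \<gamma> s) (subst \<gamma> t)"
| "subst \<gamma> (Abs \<sigma> t) = Abs \<sigma> (subst \<gamma> t)"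
| "subst \<gamma> (Meta Z ts) =
    (if Inr Z \<in> sdom \<gamma> then meta_app (\<gamma> (Inr Z)) (map (subst \<gamma>) ts)
     else Meta Z (map (subst \<gamma>) ts))"

definition var_subst :: "('v \<Rightarrow> ('f, 'v, 'm, 's) mterm) \<Rightarrow> ('f, 'v, 'm, 's) subst" where
  "var_subst g = case_sum g meta_id"

definition subst1 :: "'v \<Rightarrow> ('f, 'v, 'm, 's) mterm \<Rightarrow> ('f, 'v, 'm, 's) mterm \<Rightarrow> ('f, 'v, 'm, 's) mterm" where
  "subst1 x t s = subst (var_subst (Free(x := t))) s"

definition is_rule :: "('f, 's) sig \<Rightarrow> ('f, 'v, 'm, 's) rule \<Rightarrow> bool" where
  "is_rule F \<rho> = (case \<rho> of (l, r) \<Rightarrow>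
    (\<exists>\<sigma>. has_type F [] l \<sigma> \<and> has_type F [] r \<sigma>) \<and> FV l = {} \<and> FV r = {} \<and>
    pattern l \<and> (\<exists>f ls. l = apps (Fn f) ls) \<and> FMV r \<subseteq> FMV l)"

definition afsm :: "('f, 's) sig \<Rightarrow> ('f, 'v, 'm, 's) rule set \<Rightarrow> bool" where
  "afsm F R \<longleftrightarrow> (\<forall>\<rho>\<in>R. is_rule F \<rho>)"

inductive red :: "('f, 's) sig \<Rightarrow> ('f, 'v, 'm, 's) rule set \<Rightarrow>
    ('f, 'v, 'm, 's) mterm \<Rightarrow> ('f, 'v, 'm, 's) mterm \<Rightarrow> bool"
  for F :: "('f, 's) sig" and R :: "('f, 'v, 'm, 's) rule set" where
  "(l, r) \<in> R \<Longrightarrow> is_subst F \<delta> \<Longrightarrow> sdom \<delta> = Inr ` FMV l \<Longrightarrow> red F R (subst \<delta> l) (subst \<delta> r)"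
| "is_term F (App (lam x s) t) \<Longrightarrow> red F R (App (lam x s) t) (subst1 x t s)"
| "red F R s s' \<Longrightarrow> is_term F (App s t) \<Longrightarrow> red F R (App s t) (App s' t)"
| "red F R t t' \<Longrightarrow> is_term F (App s t) \<Longrightarrow> red F R (App s t) (App s t')"
| "red F R s s' \<Longrightarrow> red F R (lam x s) (lam x s')"

text \<open>
  In \<open>\<gamma> Z = \<lambda>x\<^sub>1\<dots>x\<^sub>j. t\<close> all leading abstractions are displayed; for arbitrary \<open>j\<close> every
  condition would hold through \<open>j = 0\<close>.
\<close>

definition respects_conds :: "('f, 'v, 'm, 's) subst \<Rightarrow> ('m \<times> nat) set \<Rightarrow> bool" where
  "respects_conds \<gamma> A \<longleftrightarrow> (\<forall>(Z, i)\<in>A. \<exists>xs t. \<gamma> (Inr Z) = lams xs t \<and> distinct xs \<and> \<not> is_abs t \<and>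
    (i > length xs \<or> 1 \<le> i \<and> i \<le> length xs \<and> xs ! (i - 1) \<in> FV t))"

inductive beta_sub :: "('m \<times> nat) set \<Rightarrow> ('f, 'v, 'm, 's) mterm \<Rightarrow> ('f, 'v, 'm, 's) mterm \<Rightarrow> bool"
  for A :: "('m \<times> nat) set" where
  "beta_sub A s s"
| "beta_sub A u t \<Longrightarrow> beta_sub A (lam x u) t"
| "s \<in> set ss \<Longrightarrow> beta_sub A s t \<Longrightarrow> beta_sub A (apps (lam x u) ss) t"
| "beta_sub A (apps (subst1 x s u) ss) t \<Longrightarrow> beta_sub A (apps (lam x u) (s # ss)) t"
| "s \<in> set ss \<Longrightarrow> beta_sub A s t \<Longrightarrow> beta_sub A (apps (Fn f) ss) t"
| "s \<in> set ss \<Longrightarrow> beta_sub A s t \<Longrightarrow> beta_sub A (apps (Free x) ss) t"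
| "s \<in> set ss \<Longrightarrow> beta_sub A s t \<Longrightarrow> beta_sub A (apps (Meta Z ts) ss) t"
| "(Z, i) \<in> A \<Longrightarrow> 1 \<le> i \<Longrightarrow> i \<le> length ts \<Longrightarrow> beta_sub A (ts ! (i - 1)) t
    \<Longrightarrow> beta_sub A (apps (Meta Z ts) ss) t"

definition cand :: "('f, 'v, 'm, 's) rule set \<Rightarrow> ('f \<Rightarrow> nat) \<Rightarrow> ('f, 'v, 'm, 's) mterm \<Rightarrow>
    (('f, 'v, 'm, 's) mterm \<times> ('m \<times> nat) set) set" where
  "cand R minar s = {(t, A).
    (\<exists>f ts. t = apps (Fn f) ts \<and> f \<in> defined_symbols R \<and> length ts = minar f) \<and>
    (\<exists>us. beta_sub A s (apps t us)) \<and> \<not> (\<exists>A'. A' \<subset> A \<and> beta_sub A' s t)}"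

text \<open>\<open>is_sharp R minar s s'\<close>: the meta-term \<open>s\<^sup>\<sharp>\<close> is defined and equal to \<open>s'\<close>.\<close>

definition is_sharp :: "('f, 'v, 'm, 's) rule set \<Rightarrow> ('f \<Rightarrow> nat) \<Rightarrow>
    ('f, 'v, 'm, 's) mterm \<Rightarrow> ('f marked, 'v, 'm, 's) mterm \<Rightarrow> bool" where
  "is_sharp R minar s s' \<longleftrightarrow> (\<exists>f ss. s = apps (Fn f) ss \<and> f \<in> defined_symbols R \<and>
    length ss = minar f \<and> s' = apps (Fn (Sharp f)) (map plain ss))"

text \<open>
  \<open>is_metafy M s s'\<close>: \<open>s'\<close> is \<open>metafy(s)\<close> for some choice of pairwise distinct fresh
  meta-variables outside \<open>M\<close>.  All choices are admitted, so \<open>SDP\<close> is closed under renaming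
  of the fresh meta-variables.
\<close>

definition is_metafy :: "'m set \<Rightarrow> ('f, 'v, 'm, 's) mterm \<Rightarrow> ('f, 'v, 'm, 's) mterm \<Rightarrow> bool" where
  "is_metafy M s s' \<longleftrightarrow> (\<exists>\<xi>. inj_on \<xi> (FV s) \<and>
    (\<forall>x\<in>FV s. mty (\<xi> x) = vty x \<and> arity (\<xi> x) = 0 \<and> \<xi> x \<notin> M) \<and>
    s' = subst (var_subst (\<lambda>x. if x \<in> FV s then Meta (\<xi> x) [] else Free x)) s)"

definition SDP :: "('f, 'v, 'm, 's) rule set \<Rightarrow> ('f \<Rightarrow> nat) \<Rightarrow> ('f marked, 'v, 'm, 's) dp set" where
  "SDP R minar = {(l', q, A) | l' q A. \<exists>l r p p'.
    (l, r) \<in> R \<and> (p, A) \<in> cand R minar r \<and> is_sharp R minar l l' \<and> is_sharp R minar p p' \<and>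
    is_metafy (FMV l' \<union> FMV p' \<union> fst ` A) p' q}"

text \<open>
  Here \<open>F\<close> and \<open>R\<close> are meant to be \<open>sharp_sig\<close> and \<open>plain_rules\<close> of the given AFSM.
\<close>

definition infinite_chain :: "('f, 's) sig \<Rightarrow> ('f, 'v, 'm, 's) dp set \<Rightarrow> ('f, 'v, 'm, 's) rule set \<Rightarrow>
    (nat \<Rightarrow> ('f, 'v, 'm, 's) dp \<times> ('f, 'v, 'm, 's) mterm \<times> ('f, 'v, 'm, 's) mterm) \<Rightarrow> bool" where
  "infinite_chain F P R C \<longleftrightarrow> (\<forall>i. case C i of ((l, p, A), s, t) \<Rightarrow>
    (l, p, A) \<in> P \<and> is_term F s \<and> is_term F t \<and>
    (\<exists>\<gamma>. is_subst F \<gamma> \<and> sdom \<gamma> = Inr ` (FMV l \<union> FMV p) \<and> respects_conds \<gamma> A \<and>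
      s = subst \<gamma> l \<and> t = subst \<gamma> p) \<and>
    (\<exists>f us ws. t = apps (Fn f) us \<and> fst (snd (C (Suc i))) = apps (Fn f) ws \<and>
      list_all2 (red F R)\<^sup>*\<^sup>* us ws))"

definition terminating :: "('f, 's) sig \<Rightarrow> ('f, 'v, 'm, 's) rule set \<Rightarrow> bool" where
  "terminating F R \<longleftrightarrow> \<not> (\<exists>u. \<forall>i::nat. red F R (u i) (u (Suc i)))"

end

end

theory Submission
  imports Defs
begin

text \<open>
  A conservative static dependency pair introduces no fresh meta-variables, so after erasing the
  marks each chain element \<open>s\<^sub>i = \<ell>\<gamma>\<close> rewrites to \<open>r\<gamma>\<close>, and \<open>p\<gamma>\<close> is reached from \<open>r\<gamma>\<close> by \<open>\<beta>\<close>-steps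
  and passing to subterms: the conditions in \<open>A\<close> ensure that the arguments of a meta-variable
  survive instantiation. Rewriting is closed under contexts, so a subterm step followed by a
  rewrite step can be turned into a rewrite step followed by a subterm step. Postponing all subterm
  steps leaves an infinite reduction.
\<close>

section \<open>Quasi-commuting relations\<close>

lemma rtrancl_Un_relcomp_subset_relto:
  "(r \<union> q)\<^sup>* O r \<subseteq> (q\<^sup>* O r O q\<^sup>*)\<^sup>+"
proof (rule subrelI)
  fix x z assume "(x, z) \<in> (r \<union> q)\<^sup>* O r"
  then obtain y where "(x, y) \<in> (r \<union> q)\<^sup>*" "(y, z) \<in> r" by blast
  then show "(x, z) \<in> (q\<^sup>* O r O q\<^sup>*)\<^sup>+"
  proof (induction rule: converse_rtrancl_induct)
    case base
    then show ?case by blast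
  next
    case (step x x')
    then have relto: "(x', z) \<in> (q\<^sup>* O r O q\<^sup>*)\<^sup>+" by blast
    from step.hyps(1) show ?case
    proof
      assume "(x, x') \<in> r"
      then have "(x, x') \<in> q\<^sup>* O r O q\<^sup>*" by blast
      then show ?thesis using relto by (rule trancl_into_trancl2)
    next
      assume q: "(x, x') \<in> q"
      from relto obtain y where "(x', y) \<in> q\<^sup>* O r O q\<^sup>*" "(y, z) \<in> (q\<^sup>* O r O q\<^sup>*)\<^sup>*"
        by (auto simp: trancl_unfold_left)
      moreover from this(1) have "(x, y) \<in> q\<^sup>* O r O q\<^sup>*"
        using q by (blast intro: converse_rtrancl_into_rtrancl)
      ultimately show ?thesis by (auto simp: trancl_unfold_left)
    qed
  qed
qed

lemma infinite_chain_if_quasi_commute: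
  fixes r q :: "'a \<Rightarrow> 'a \<Rightarrow> bool"
  assumes quasi_commute: "q OO r \<le> r OO (sup r q)\<^sup>*\<^sup>*"
    and chain: "\<And>i. (r OO (sup r q)\<^sup>*\<^sup>*) (a i) (a (Suc i))"
  shows "\<exists>u. \<forall>i. r (u i) (u (Suc i))"
proof (rule ccontr)
  define r' q' where "r' = {(y, x). r x y}" and "q' = {(y, x). q x y}"
  have converse_steps: "(sup r q)\<^sup>*\<^sup>* x y \<longleftrightarrow> (y, x) \<in> (r' \<union> q')\<^sup>*" for x y
  proof -
    have "r' \<union> q' = {(x, y). sup r q x y}\<inverse>" by (auto simp: r'_def q'_def)
    then show ?thesis by (simp add: rtrancl_converse rtranclp_rtrancl_eq)
  qed
  assume "\<nexists>u. \<forall>i. r (u i) (u (Suc i))"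
  then have "wf r'" by (simp add: wf_iff_no_infinite_down_chain r'_def)
  moreover have "r' O q' \<subseteq> (r' \<union> q')\<^sup>* O r'"
    using quasi_commute by (fastforce simp: converse_steps r'_def q'_def)
  ultimately have "wf ((q'\<^sup>* O r' O q'\<^sup>*)\<^sup>+)" by (simp add: qc_wf_relto_iff wf_trancl)
  moreover have "(a (Suc i), a i) \<in> (r' \<union> q')\<^sup>* O r'" for i
    using chain[of i] by (auto simp: converse_steps r'_def)
  ultimately show False
    using rtrancl_Un_relcomp_subset_relto[of r' q'] by (auto simp: wf_iff_no_infinite_down_chain)
qed

section \<open>Locally nameless meta-terms\<close>

fun lc_at :: "nat \<Rightarrow> ('f, 'v, 'm, 's) mterm \<Rightarrow> bool" where
  "lc_at k (Free x) \<longleftrightarrow> True"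
| "lc_at k (Bnd i) \<longleftrightarrow> i < k"
| "lc_at k (Fn f) \<longleftrightarrow> True"
| "lc_at k (App s t) \<longleftrightarrow> lc_at k s \<and> lc_at k t"
| "lc_at k (Abs \<sigma> t) \<longleftrightarrow> lc_at (Suc k) t"
| "lc_at k (Meta Z ts) \<longleftrightarrow> (\<forall>t\<in>set ts. lc_at k t)"

lemma lc_at_mono: "lc_at k t \<Longrightarrow> k \<le> k' \<Longrightarrow> lc_at k' t"
proof (induction t arbitrary: k k')
  case (Abs \<sigma> t)
  then show ?case by (metis Suc_le_mono lc_at.simps(5))
qed auto

lemma lc_at_foldr_Abs: "lc_at k (foldr Abs \<sigma>s t) \<longleftrightarrow> lc_at (length \<sigma>s + k) t"
  by (induction \<sigma>s arbitrary: k) auto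

lemma shift_0 [simp]: "shift 0 c t = t"
  by (induction t arbitrary: c) (auto intro: map_idI)

lemma shift_lc: "lc_at c t \<Longrightarrow> shift d c t = t"
  by (induction t arbitrary: c) (auto intro: map_idI)

lemma inst_lc: "lc_at c t \<Longrightarrow> inst c ws t = t"
  by (induction t arbitrary: c) (auto intro: map_idI)

lemma inst_apps: "inst c ws (apps h ts) = apps (inst c ws h) (map (inst c ws) ts)"
  by (induction ts arbitrary: h) auto

lemma inst_bind: "inst c [Free x] (bind c x t) = t"
  by (induction t arbitrary: c) (auto simp: map_idI)

lemma bind_inst: "x \<notin> FV t \<Longrightarrow> bind c x (inst c [Free x] t) = t"
  by (induction t arbitrary: c) (auto simp: map_idI)

lemma inst_shift_Suc: "inst (c + e) [v] (shift (Suc c) e t) = shift c e t"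
proof (induction t arbitrary: e)
  case (Abs \<sigma> t)
  then show ?case using Abs.IH[of "Suc e"] by simp
qed auto

lemma inst_Cons: "inst c [v] (inst (Suc c) ws t) = inst c (v # ws) t"
  using inst_shift_Suc[where e = 0]
  by (induction t arbitrary: c) (auto simp: nth_Cons')

lemma inst_shift:
  assumes "\<forall>w\<in>set ws. lc_at 0 w"
  shows "e \<le> c \<Longrightarrow> inst (c + d) ws (shift d e t) = shift d e (inst c ws t)"
proof (induction t arbitrary: c e)
  case (Bnd i)
  have "shift k j w = w" if "w \<in> set ws" for w k j
    using that assms lc_at_mono[of 0 w j] by (simp add: shift_lc)
  with Bnd show ?case by (auto simp: less_diff_conv2)
next
  case (Abs \<sigma> t)
  then show ?case using Abs.IH[of "Suc e" "Suc c"] by simp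
qed auto

lemma inst_inst:
  assumes "\<forall>w\<in>set ws. lc_at 0 w"
  shows "lc_at (d + length vs) t \<Longrightarrow> inst (c + d) ws (inst d vs t) = inst d (map (inst c ws) vs) t"
proof (induction t arbitrary: d)
  case (Bnd i)
  then show ?case using inst_shift[OF assms, of 0 c d] by (auto simp: less_diff_conv2)
next
  case (Abs \<sigma> t)
  then show ?case using Abs.IH[of "Suc d"] by simp
qed auto

lemma strip_abs_le: "strip_abs k t = (n, u) \<Longrightarrow> n \<le> k"
  by (induction k t arbitrary: n u rule: strip_abs.induct) (auto split: prod.splits)

lemma lc_at_strip_abs: "strip_abs k t = (n, u) \<Longrightarrow> lc_at c t \<Longrightarrow> lc_at (c + n) u"
  by (induction k t arbitrary: n u c rule: strip_abs.induct)
    (auto split: prod.splits simp flip: add_Suc)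

lemma FMV_strip_abs: "strip_abs k t = (n, u) \<Longrightarrow> FMV u = FMV t"
  by (induction k t arbitrary: n u rule: strip_abs.induct) (auto split: prod.splits)

lemma FV_strip_abs: "strip_abs k t = (n, u) \<Longrightarrow> FV u = FV t"
  by (induction k t arbitrary: n u rule: strip_abs.induct) (auto split: prod.splits)

lemma strip_abs_not_is_abs: "\<not> is_abs t \<Longrightarrow> strip_abs k t = (0, t)"
  by (cases k; cases t) auto

lemma strip_abs_bind:
  "strip_abs k (bind c x t) = (case strip_abs k t of (n, u) \<Rightarrow> (n, bind (c + n) x u))"
  by (induction k t arbitrary: c rule: strip_abs.induct) (auto split: prod.splits)

lemma inst_meta_app:
  assumes "\<forall>w\<in>set ws. lc_at 0 w" and "lc_at 0 v"
  shows "inst c ws (meta_app v ss) = meta_app v (map (inst c ws) ss)"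
proof -
  obtain n u where strip: "strip_abs (length ss) v = (n, u)" by fastforce
  have "n \<le> length ss" "lc_at n u"
    using strip_abs_le[OF strip] lc_at_strip_abs[OF strip assms(2)] by auto
  then show ?thesis
    using strip inst_inst[OF assms(1), of 0 "rev (take n ss)" u c]
    by (simp add: meta_app_def inst_apps rev_map take_map drop_map)
qed

lemma finite_FV: "finite (FV t)"
  by (induction t) auto

lemma FV_bind [simp]: "FV (bind c x t) = FV t - {x}"
  by (induction t arbitrary: c) auto

lemma FMV_bind [simp]: "FMV (bind c x t) = FMV t"
  by (induction t arbitrary: c) auto

lemma FMV_shift [simp]: "FMV (shift d c t) = FMV t"
  by (induction t arbitrary: c) auto

lemma FMV_apps: "FMV (apps h ts) = FMV h \<union> \<Union>(FMV ` set ts)"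
  by (induction ts arbitrary: h) auto

lemma FMV_inst: "FMV (inst c ws t) \<subseteq> FMV t \<union> \<Union>(FMV ` set ws)"
proof (induction t arbitrary: c)
  case (App s t)
  then show ?case by simp blast
next
  case (Meta Z ts)
  then show ?case by auto
qed (auto intro: nth_mem)

lemma FMV_meta_app: "FMV (meta_app v ss) \<subseteq> FMV v \<union> \<Union>(FMV ` set ss)"
proof -
  obtain n u where strip: "strip_abs (length ss) v = (n, u)" by fastforce
  then show ?thesis
    using FMV_strip_abs[OF strip] FMV_inst[of 0 "rev (take n ss)" u]
    by (auto simp: meta_app_def FMV_apps dest: in_set_takeD in_set_dropD)
qed

text \<open>Arguments of meta-variables do not count, as a substitution may erase them.\<close>

fun occurs_Bnd :: "nat \<Rightarrow> ('f, 'v, 'm, 's) mterm \<Rightarrow> bool" where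
  "occurs_Bnd m (Bnd i) \<longleftrightarrow> i = m"
| "occurs_Bnd m (App s t) \<longleftrightarrow> occurs_Bnd m s \<or> occurs_Bnd m t"
| "occurs_Bnd m (Abs \<sigma> t) \<longleftrightarrow> occurs_Bnd (Suc m) t"
| "occurs_Bnd m _ \<longleftrightarrow> False"

lemma occurs_Bnd_bind: "m < c \<Longrightarrow> occurs_Bnd m t \<Longrightarrow> occurs_Bnd m (bind c x t)"
  by (induction t arbitrary: m c) auto

lemma occurs_Bnd_bind_self: "x \<in> FV t \<Longrightarrow> FMV t = {} \<Longrightarrow> occurs_Bnd c (bind c x t)"
  by (induction t arbitrary: c) auto

definition lc_subst :: "('f, 'v, 'm, 's) subst \<Rightarrow> bool" where
  "lc_subst \<gamma> \<longleftrightarrow> (\<forall>a. lc_at 0 (\<gamma> a))"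

context symbols
begin

lemma Inr_in_sdom [simp]: "Inr Z \<in> sdom \<gamma> \<longleftrightarrow> \<gamma> (Inr Z) \<noteq> meta_id Z"
  by (auto simp: sdom_def)

lemma var_subst_simps [simp]: "var_subst g (Inl x) = g x" "var_subst g (Inr Z) = meta_id Z"
  by (simp_all add: var_subst_def)

lemma var_subst_upd: "(var_subst g)(Inl x := w) = var_subst (g(x := w))"
  by (auto simp: var_subst_def fun_eq_iff split: sum.splits)

lemma lc_at_meta_id: "lc_at 0 (meta_id Z)"
  using arity_le[of Z] by (simp add: meta_id_def lc_at_foldr_Abs)

lemma lc_subst_var_subst: "(\<And>x. lc_at 0 (g x)) \<Longrightarrow> lc_subst (var_subst g)"
  by (simp add: lc_subst_def var_subst_def lc_at_meta_id split: sum.splits)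

lemma subst_apps: "subst \<gamma> (apps h ts) = apps (subst \<gamma> h) (map (subst \<gamma>) ts)"
  by (induction ts arbitrary: h) auto

lemma subst_var_subst_Free [simp]: "subst (var_subst Free) t = t"
  by (induction t) (auto simp: map_idI)

lemma subst_cong:
  assumes "\<gamma> \<circ> Inr = \<gamma>' \<circ> Inr" and "\<And>x. x \<in> FV t \<Longrightarrow> \<gamma> (Inl x) = \<gamma>' (Inl x)"
  shows "subst \<gamma> t = subst \<gamma>' t"
proof -
  have metas: "\<gamma> (Inr Z) = \<gamma>' (Inr Z)" for Z
    using assms(1) by (simp add: fun_eq_iff)
  show ?thesis
    using assms(2)
  proof (induction t)
    case (Meta Z ts)
    then have "map (subst \<gamma>) ts = map (subst \<gamma>') ts" by auto
    with metas show ?case by (simp del: map_eq_conv)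
  qed auto
qed

lemma subst_subst1: "subst \<gamma> (subst1 x s t) = subst (\<gamma>(Inl x := subst \<gamma> s)) t"
  unfolding subst1_def by (induction t) (auto simp: o_def cong: map_cong)

lemma FMV_subst_var_subst: "x \<in> FV t \<Longrightarrow> FMV (g x) \<subseteq> FMV (subst (var_subst g) t)"
  by (induction t) auto

lemma inst_subst_bind:
  assumes "lc_subst \<gamma>" and "lc_at 0 w"
  shows "inst c [w] (subst \<gamma> (bind c x t)) = subst (\<gamma>(Inl x := w)) t"
proof (induction t arbitrary: c)
  case (Free y)
  have "lc_at c (\<gamma> (Inl y))"
    using assms(1) lc_at_mono by (fastforce simp: lc_subst_def)
  then show ?case using assms(2) by (simp add: inst_lc shift_lc)
next
  case (Meta Z ts)
  have "lc_at 0 (\<gamma> (Inr Z))" using assms(1) by (simp add: lc_subst_def)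
  then show ?case using Meta assms(2) by (simp add: inst_meta_app o_def cong: map_cong)
qed auto

lemma subst1_eq_inst: "lc_at 0 w \<Longrightarrow> subst1 x w t = inst 0 [w] (bind 0 x t)"
  using inst_subst_bind[OF lc_subst_var_subst[of Free], of w 0 x t]
  by (simp add: subst1_def var_subst_upd)

lemma subst1_inst_Free: "lc_at 0 w \<Longrightarrow> x \<notin> FV t \<Longrightarrow> subst1 x w (inst 0 [Free x] t) = inst 0 [w] t"
  by (simp add: subst1_eq_inst bind_inst)

lemma lam_inst_Free: "x \<notin> FV t \<Longrightarrow> lam x (inst 0 [Free x] t) = Abs (vty x) t"
  by (simp add: lam_def bind_inst)

lemma fresh_var: obtains x where "vty x = \<sigma>" "x \<notin> FV t"
proof -
  have "infinite ({x. vty x = \<sigma>} - FV t)"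
    using infinite_vars finite_FV by (simp add: Diff_infinite_finite)
  then have "{x. vty x = \<sigma>} - FV t \<noteq> {}" by (rule infinite_imp_nonempty)
  then show ?thesis using that by blast
qed

lemma subst_lam:
  assumes "lc_subst \<gamma>"
  obtains y where "vty y = vty x"
    and "subst \<gamma> (lam x t) = lam y (subst (\<gamma>(Inl x := Free y)) t)"
    and "\<And>w. lc_at 0 w \<Longrightarrow> subst1 y w (subst (\<gamma>(Inl x := Free y)) t) = subst (\<gamma>(Inl x := w)) t"
proof -
  let ?body = "subst \<gamma> (bind 0 x t)"
  obtain y where y: "vty y = vty x" "y \<notin> FV ?body" by (rule fresh_var)
  have inst_body: "inst 0 [w] ?body = subst (\<gamma>(Inl x := w)) t" if "lc_at 0 w" for w
    using assms that by (rule inst_subst_bind)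
  have "subst \<gamma> (lam x t) = lam y (inst 0 [Free y] ?body)"
    using y by (simp add: lam_inst_Free) (simp add: lam_def)
  moreover have "subst1 y w (inst 0 [Free y] ?body) = inst 0 [w] ?body" if "lc_at 0 w" for w
    using that y(2) by (rule subst1_inst_Free)
  ultimately show ?thesis using that[OF y(1)] by (simp add: inst_body)
qed

lemma lams_simps [simp]: "lams [] t = t" "lams (x # xs) t = lam x (lams xs t)"
  by (simp_all add: lams_def)

lemma FV_lams: "FV (lams xs t) = FV t - set xs"
  by (induction xs) (auto simp: lam_def)

lemma FMV_lams: "FMV (lams xs t) = FMV t"
  by (induction xs) (auto simp: lam_def)

lemma strip_abs_lams_le:
  "\<not> is_abs t \<Longrightarrow> strip_abs k (lams xs t) = (n, u) \<Longrightarrow> n \<le> length xs"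
proof (induction xs arbitrary: k n u)
  case Nil
  then show ?case by (simp add: strip_abs_not_is_abs)
next
  case (Cons x xs)
  then show ?case
    by (cases k) (auto simp: lam_def strip_abs_bind split: prod.splits)
qed

lemma occurs_Bnd_strip_abs_lams:
  "distinct xs \<Longrightarrow> xs ! i \<in> FV t \<Longrightarrow> FMV t = {} \<Longrightarrow> strip_abs k (lams xs t) = (n, u) \<Longrightarrow>
    i < n \<Longrightarrow> n \<le> length xs \<Longrightarrow> occurs_Bnd (n - 1 - i) u"
proof (induction xs arbitrary: k n u i)
  case (Cons x xs)
  show ?case
  proof (cases k)
    case (Suc j)
    obtain m v where strip: "strip_abs j (lams xs t) = (m, v)" by fastforce
    then have n: "n = Suc m" and u: "u = bind m x v"
      using Cons.prems(4) Suc by (auto simp: lam_def strip_abs_bind)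
    show ?thesis
    proof (cases i)
      case 0
      then have "x \<in> FV v" "FMV v = {}"
        using Cons.prems FV_strip_abs[OF strip] FMV_strip_abs[OF strip]
        by (simp_all add: FV_lams FMV_lams)
      then show ?thesis using 0 by (simp add: n u occurs_Bnd_bind_self)
    next
      case (Suc i')
      then have "occurs_Bnd (m - 1 - i') v" using Cons.IH[OF _ _ _ strip] Cons.prems n by auto
      then show ?thesis using Suc Cons.prems(5) n by (auto simp: u intro: occurs_Bnd_bind)
    qed
  qed (use Cons in \<open>simp add: lam_def\<close>)
qed simp

section \<open>Typing\<close>

lemmas has_type_Free = has_type.intros(1)
  and has_type_App = has_type.intros(4)
  and has_type_Meta = has_type.intros(6)

lemmas has_type_induct [consumes 1, case_names Free Bnd Fn App Abs Meta] = has_type.induct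

inductive_cases has_type_AppE: "has_type F \<Gamma> (App s t) \<tau>"
inductive_cases has_type_AbsE: "has_type F \<Gamma> (Abs \<sigma> t) \<tau>"

lemma has_type_BndI: "i < length \<Gamma> \<Longrightarrow> \<Gamma> ! i = \<sigma> \<Longrightarrow> has_type F \<Gamma> (Bnd i) \<sigma>"
  using has_type.intros(2) by metis

lemma has_type_Meta_mapI:
  "length ss = arity Z \<Longrightarrow> mty Z = foldr Fun \<sigma>s \<tau> \<Longrightarrow>
    list_all2 (\<lambda>s \<sigma>. has_type F \<Gamma> (f s) \<sigma>) ss \<sigma>s \<Longrightarrow> has_type F \<Gamma> (Meta Z (map f ss)) \<tau>"
  by (auto intro: has_type.intros simp: list_all2_map1)

lemma has_type_apps:
  "list_all2 (has_type F \<Gamma>) ts \<sigma>s \<Longrightarrow> has_type F \<Gamma> h (foldr Fun \<sigma>s \<tau>) \<Longrightarrow> has_type F \<Gamma> (apps h ts) \<tau>"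
  by (induction arbitrary: h rule: list_all2_induct) (auto intro: has_type.intros)

lemma has_type_imp_lc_at: "has_type F \<Gamma> t \<sigma> \<Longrightarrow> lc_at (length \<Gamma>) t"
  by (induction rule: has_type_induct) (auto simp: list_all2_conv_all_nth in_set_conv_nth)

lemma foldr_Fun_result_unique:
  "length \<sigma>s = length \<sigma>s' \<Longrightarrow> foldr Fun \<sigma>s \<tau> = foldr Fun \<sigma>s' \<tau>' \<Longrightarrow> \<tau> = \<tau>'"
  by (induction rule: list_induct2) auto

lemma has_type_unique: "has_type F \<Gamma> t \<sigma> \<Longrightarrow> has_type F \<Gamma> t \<sigma>' \<Longrightarrow> \<sigma> = \<sigma>'"
proof (induction arbitrary: \<sigma>' rule: has_type_induct)
  case (Meta ss Z \<sigma>s \<tau> \<Gamma>)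
  from Meta.prems obtain \<sigma>s' where "length \<sigma>s' = length ss" "mty Z = foldr Fun \<sigma>s' \<sigma>'"
    by cases (auto dest: list_all2_lengthD)
  then show ?case
    using foldr_Fun_result_unique[of \<sigma>s \<sigma>s'] Meta.hyps(2) list_all2_lengthD[OF Meta.IH] by simp
next
  case (Fn f \<sigma> \<Gamma>)
  from Fn.prems show ?case by cases (use Fn.hyps in simp)
next
  case (App \<Gamma> s \<sigma> \<tau> t)
  then show ?case by (fast elim: has_type_AppE)
next
  case (Abs \<sigma> \<Gamma> s \<tau>)
  then show ?case by (fast elim: has_type_AbsE)
qed (auto elim: has_type.cases)

lemma has_type_weaken: "has_type F \<Gamma> t \<sigma> \<Longrightarrow> has_type F (\<Gamma> @ \<Gamma>') t \<sigma>"
proof (induction rule: has_type_induct)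
  case (Bnd i \<Gamma>)
  then show ?case by (auto simp: nth_append intro: has_type_BndI)
next
  case (Meta ss Z \<sigma>s \<tau> \<Gamma>)
  then show ?case by (auto intro: has_type_Meta elim: list_all2_mono)
qed (auto intro: has_type.intros)

lemma has_type_shift:
  "has_type F (\<Gamma>\<^sub>0 @ \<Gamma>\<^sub>2) t \<sigma> \<Longrightarrow>
    has_type F (\<Gamma>\<^sub>0 @ \<Gamma>\<^sub>1 @ \<Gamma>\<^sub>2) (shift (length \<Gamma>\<^sub>1) (length \<Gamma>\<^sub>0) t) \<sigma>"
proof (induction "\<Gamma>\<^sub>0 @ \<Gamma>\<^sub>2" t \<sigma> arbitrary: \<Gamma>\<^sub>0 rule: has_type_induct)
  case (Bnd i)
  then show ?case by (auto simp: nth_append intro!: has_type_BndI)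
next
  case (Abs \<sigma> s \<tau>)
  then show ?case using Abs.hyps(2)[of "\<sigma> # \<Gamma>\<^sub>0"] by (auto intro: has_type.intros)
next
  case (Meta ss Z \<sigma>s \<tau>)
  then show ?case by (auto intro!: has_type_Meta_mapI elim: list_all2_mono)
qed (auto intro: has_type.intros)

lemma has_type_bind:
  "has_type F (\<Gamma>\<^sub>0 @ \<Gamma>\<^sub>2) t \<sigma> \<Longrightarrow> has_type F (\<Gamma>\<^sub>0 @ vty x # \<Gamma>\<^sub>2) (bind (length \<Gamma>\<^sub>0) x t) \<sigma>"
proof (induction "\<Gamma>\<^sub>0 @ \<Gamma>\<^sub>2" t \<sigma> arbitrary: \<Gamma>\<^sub>0 rule: has_type_induct)
  case (Free y)
  then show ?case by (auto intro: has_type_Free has_type_BndI)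
next
  case (Bnd i)
  then show ?case by (auto simp: nth_append Suc_diff_le intro!: has_type_BndI)
next
  case (Abs \<sigma> s \<tau>)
  then show ?case using Abs.hyps(2)[of "\<sigma> # \<Gamma>\<^sub>0"] by (auto intro: has_type.intros)
next
  case (Meta ss Z \<sigma>s \<tau>)
  then show ?case by (auto intro!: has_type_Meta_mapI elim: list_all2_mono)
qed (auto intro: has_type.intros)

lemma has_type_inst:
  assumes ws: "list_all2 (has_type F \<Gamma>\<^sub>2) ws \<sigma>s"
  shows "has_type F (\<Gamma>\<^sub>0 @ \<sigma>s @ \<Gamma>\<^sub>2) t \<tau> \<Longrightarrow> has_type F (\<Gamma>\<^sub>0 @ \<Gamma>\<^sub>2) (inst (length \<Gamma>\<^sub>0) ws t) \<tau>"
proof (induction "\<Gamma>\<^sub>0 @ \<sigma>s @ \<Gamma>\<^sub>2" t \<tau> arbitrary: \<Gamma>\<^sub>0 rule: has_type_induct)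
  case (Bnd i)
  have length_ws: "length ws = length \<sigma>s" using ws by (rule list_all2_lengthD)
  show ?case
  proof (cases "length \<Gamma>\<^sub>0 \<le> i \<and> i - length \<Gamma>\<^sub>0 < length \<sigma>s")
    case True
    then have "has_type F \<Gamma>\<^sub>2 (ws ! (i - length \<Gamma>\<^sub>0)) (\<sigma>s ! (i - length \<Gamma>\<^sub>0))"
      using ws by (simp add: list_all2_conv_all_nth)
    then have "has_type F (\<Gamma>\<^sub>0 @ \<Gamma>\<^sub>2)
        (shift (length \<Gamma>\<^sub>0) 0 (ws ! (i - length \<Gamma>\<^sub>0))) (\<sigma>s ! (i - length \<Gamma>\<^sub>0))"
      using has_type_shift[of F "[]" \<Gamma>\<^sub>2 _ _ \<Gamma>\<^sub>0] by simp
    then show ?thesis using True length_ws by (simp add: nth_append)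
  next
    case False
    then show ?thesis
      using Bnd length_ws by (auto simp: nth_append add.commute intro!: has_type_BndI)
  qed
next
  case (Abs \<sigma> s \<tau>)
  then show ?case using Abs.hyps(2)[of "\<sigma> # \<Gamma>\<^sub>0"] by (auto intro: has_type.intros)
next
  case (Meta ss Z \<sigma>s' \<tau>)
  then show ?case by (auto intro!: has_type_Meta_mapI elim: list_all2_mono)
qed (auto intro: has_type.intros)

lemma has_type_strip_abs:
  "strip_abs (length \<sigma>s) v = (n, u) \<Longrightarrow> has_type F \<Gamma> v (foldr Fun \<sigma>s \<tau>) \<Longrightarrow>
    has_type F (rev (take n \<sigma>s) @ \<Gamma>) u (foldr Fun (drop n \<sigma>s) \<tau>)"
proof (induction \<sigma>s arbitrary: v n u \<Gamma>)
  case (Cons \<sigma> \<sigma>s)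
  show ?case
  proof (cases v)
    case (Abs \<sigma>' t)
    obtain m w where strip: "strip_abs (length \<sigma>s) t = (m, w)" by fastforce
    have "\<sigma>' = \<sigma>" "has_type F (\<sigma> # \<Gamma>) t (foldr Fun \<sigma>s \<tau>)"
      using Cons.prems(2) Abs by (auto elim: has_type_AbsE)
    moreover have "n = Suc m" "u = w" using Cons.prems(1) Abs strip by simp_all
    ultimately show ?thesis using Cons.IH[OF strip, of "\<sigma> # \<Gamma>"] by simp
  qed (use Cons.prems in auto)
qed simp

lemma has_type_meta_app:
  assumes ss: "list_all2 (has_type F \<Gamma>) ss \<sigma>s" and v: "has_type F \<Gamma> v (foldr Fun \<sigma>s \<tau>)"
  shows "has_type F \<Gamma> (meta_app v ss) \<tau>"
proof -
  obtain n u where strip: "strip_abs (length ss) v = (n, u)" by fastforce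
  then have "has_type F (rev (take n \<sigma>s) @ \<Gamma>) u (foldr Fun (drop n \<sigma>s) \<tau>)"
    using has_type_strip_abs v list_all2_lengthD[OF ss] by metis
  moreover have "list_all2 (has_type F \<Gamma>) (rev (take n ss)) (rev (take n \<sigma>s))"
    using ss by (simp add: list_all2_takeI)
  ultimately have "has_type F \<Gamma> (inst 0 (rev (take n ss)) u) (foldr Fun (drop n \<sigma>s) \<tau>)"
    using has_type_inst[of F \<Gamma> "rev (take n ss)" "rev (take n \<sigma>s)" "[]"] by simp
  moreover have "list_all2 (has_type F \<Gamma>) (drop n ss) (drop n \<sigma>s)"
    using ss by (simp add: list_all2_dropI)
  ultimately show ?thesis using strip by (simp add: meta_app_def has_type_apps)
qed

lemma has_type_subst:
  assumes "is_subst F \<gamma>"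
  shows "has_type F \<Gamma> t \<tau> \<Longrightarrow> has_type F \<Gamma> (subst \<gamma> t) \<tau>"
proof (induction rule: has_type_induct)
  case (Free \<Gamma> x)
  then show ?case using assms has_type_weaken[of F "[]" _ _ \<Gamma>] by (simp add: is_subst_def)
next
  case (Meta ss Z \<sigma>s \<tau> \<Gamma>)
  have args: "list_all2 (has_type F \<Gamma>) (map (subst \<gamma>) ss) \<sigma>s"
    using Meta.IH by (auto simp: list_all2_map1 elim: list_all2_mono)
  have "has_type F \<Gamma> (\<gamma> (Inr Z)) (foldr Fun \<sigma>s \<tau>)"
    using assms Meta.hyps(2) has_type_weaken[of F "[]" _ _ \<Gamma>] by (metis append_Nil is_subst_def)
  with args have "has_type F \<Gamma> (meta_app (\<gamma> (Inr Z)) (map (subst \<gamma>) ss)) \<tau>"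
    by (rule has_type_meta_app)
  then show ?case using has_type_Meta[OF _ Meta.hyps(2) args] Meta.hyps(1) by simp
qed (auto intro: has_type.intros)

lemma has_type_lam: "has_type F [] s \<tau> \<Longrightarrow> has_type F [] (lam x s) (Fun (vty x) \<tau>)"
  using has_type_bind[of F "[]" "[]"] by (auto simp: lam_def intro: has_type.intros)

lemma has_type_lamE:
  assumes "has_type F [] (lam x s) \<sigma>"
  obtains \<tau> where "\<sigma> = Fun (vty x) \<tau>" "has_type F [vty x] (bind 0 x s) \<tau>" "has_type F [] s \<tau>"
proof -
  from assms obtain \<tau> where \<tau>: "\<sigma> = Fun (vty x) \<tau>" "has_type F [vty x] (bind 0 x s) \<tau>"
    by (auto simp: lam_def elim: has_type_AbsE)
  have "has_type F [] (inst 0 [Free x] (bind 0 x s)) \<tau>"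
    using has_type_inst[of F "[]" "[Free x]" "[vty x]" "[]"] \<tau>(2) by (simp add: has_type.intros)
  with \<tau> that show thesis by (simp add: inst_bind)
qed

lemma is_termE:
  assumes "is_term F s"
  obtains \<sigma> where "has_type F [] s \<sigma>" "FMV s = {}"
  using assms by (auto simp: is_term_def is_mterm_def)

lemma is_termI: "has_type F [] s \<sigma> \<Longrightarrow> FMV s = {} \<Longrightarrow> is_term F s"
  by (auto simp: is_term_def is_mterm_def)

lemma is_term_imp_lc: "is_term F s \<Longrightarrow> lc_at 0 s"
  by (erule is_termE, drule has_type_imp_lc_at) simp

lemma is_term_AppD: "is_term F (App s t) \<Longrightarrow> is_term F s \<and> is_term F t"
  by (auto simp: is_term_def is_mterm_def elim!: has_type_AppE)

lemma is_term_apps_head: "is_term F (apps h ts) \<Longrightarrow> is_term F h"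
  by (induction ts arbitrary: h) (auto dest: is_term_AppD)

lemma is_term_lamD: "is_term F (lam x s) \<Longrightarrow> is_term F s"
  by (elim is_termE, erule has_type_lamE, rule is_termI) (simp_all add: lam_def)

lemma is_subst_imp_lc_subst: "is_subst F \<gamma> \<Longrightarrow> lc_subst \<gamma>"
  unfolding is_subst_def lc_subst_def using has_type_imp_lc_at by (metis list.size(3) sum.exhaust)

lemma is_subst_FMV: "is_subst F \<gamma> \<Longrightarrow> Inr Z \<in> sdom \<gamma> \<Longrightarrow> FMV (\<gamma> (Inr Z)) = {}"
  unfolding is_subst_def is_term_def by blast

lemma is_subst_upd:
  "is_subst F \<gamma> \<Longrightarrow> has_type F [] w (vty x) \<Longrightarrow> FMV w = {} \<Longrightarrow> is_subst F (\<gamma>(Inl x := w))"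
  by (auto simp: is_subst_def sdom_def intro: is_termI)

lemma FMV_subst_eq_empty:
  assumes "is_subst F \<gamma>"
  shows "Inr ` FMV t \<subseteq> sdom \<gamma> \<Longrightarrow> FMV (subst \<gamma> t) = {}"
proof (induction t)
  case (Free x)
  have "\<gamma> (Inl x) = Free x \<or> Inl x \<in> sdom \<gamma>" by (auto simp: sdom_def)
  then show ?case using assms by (auto simp: is_subst_def is_term_def)
next
  case (Meta Z ts)
  then have "Inr Z \<in> sdom \<gamma>" by auto
  moreover from this have "FMV (\<gamma> (Inr Z)) = {}" using assms by (rule is_subst_FMV[rotated])
  moreover have "\<forall>t\<in>set ts. FMV (subst \<gamma> t) = {}" using Meta by auto
  ultimately show ?case using FMV_meta_app[of "\<gamma> (Inr Z)" "map (subst \<gamma>) ts"] by auto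
qed auto

end

section \<open>Rewriting and subterms\<close>

lemmas (in symbols) red_root = red.intros(1)
  and red_beta = red.intros(2)
  and red_App_fun = red.intros(3)
  and red_App_arg = red.intros(4)
  and red_lam = red.intros(5)

lemmas (in symbols) red_induct [consumes 1, case_names root beta App_fun App_arg lam] = red.induct

locale afsm_system = symbols vty mty arity
  for vty :: "'v \<Rightarrow> 's ty" and mty :: "'m \<Rightarrow> 's ty" and arity :: "'m \<Rightarrow> nat" +
  fixes F :: "('f, 's) sig" and R :: "('f, 'v, 'm, 's) rule set"
  assumes afsm: "afsm F R"
begin

lemma rule_types:
  assumes "(l, r) \<in> R"
  obtains \<sigma> where "has_type F [] l \<sigma>" "has_type F [] r \<sigma>"
  using assms afsm by (force simp: afsm_def is_rule_def)

lemma rule_FMV: "(l, r) \<in> R \<Longrightarrow> FMV r \<subseteq> FMV l"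
  using afsm by (force simp: afsm_def is_rule_def)

lemma red_has_type: "red F R s s' \<Longrightarrow> has_type F [] s \<sigma> \<Longrightarrow> has_type F [] s' \<sigma>"
proof (induction arbitrary: \<sigma> rule: red_induct)
  case (root l r \<delta>)
  from root.hyps(1) obtain \<tau> where \<tau>: "has_type F [] l \<tau>" "has_type F [] r \<tau>" by (rule rule_types)
  then have "\<tau> = \<sigma>"
    using has_type_subst[OF root.hyps(2)] has_type_unique root.prems by metis
  then show ?case using has_type_subst[OF root.hyps(2)] \<tau>(2) by simp
next
  case (beta x s t)
  then have t: "lc_at 0 t" using is_term_AppD is_term_imp_lc by blast
  from beta.prems obtain \<tau> where \<tau>: "has_type F [] (lam x s) (Fun \<tau> \<sigma>)" "has_type F [] t \<tau>"
    by (auto elim: has_type_AppE)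
  then have "has_type F [vty x] (bind 0 x s) \<sigma>" "\<tau> = vty x" by (auto elim: has_type_lamE)
  then show ?case
    using has_type_inst[of F "[]" "[t]" "[vty x]" "[]"] \<tau>(2) by (simp add: subst1_eq_inst[OF t])
next
  case (App_fun s s' t)
  then show ?case by (meson has_type_App has_type_AppE)
next
  case (App_arg t t' s)
  then show ?case by (meson has_type_App has_type_AppE)
next
  case (lam s s' x)
  from lam.prems obtain \<tau> where "\<sigma> = Fun (vty x) \<tau>" "has_type F [] s \<tau>" by (rule has_type_lamE)
  then show ?case using lam.IH by (simp add: has_type_lam)
qed

lemma red_FMV: "red F R s s' \<Longrightarrow> FMV s = {} \<Longrightarrow> FMV s' = {}"
proof (induction rule: red_induct)
  case (root l r \<delta>)
  then have "Inr ` FMV r \<subseteq> sdom \<delta>" using rule_FMV by blast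
  then show ?case using FMV_subst_eq_empty root.hyps(2) by blast
next
  case (beta x s t)
  then have t: "lc_at 0 t" using is_term_AppD is_term_imp_lc by blast
  show ?case
    using FMV_inst[of 0 "[t]" "bind 0 x s"] beta.prems by (simp add: subst1_eq_inst[OF t] lam_def)
qed (auto simp: lam_def)

lemma red_is_term: "red F R s s' \<Longrightarrow> is_term F s \<Longrightarrow> is_term F s'"
  using red_has_type red_FMV by (blast elim: is_termE intro: is_termI)

lemma reds_is_term: "(red F R)\<^sup>*\<^sup>* s t \<Longrightarrow> is_term F s \<Longrightarrow> is_term F t"
  by (induction rule: rtranclp_induct) (auto dest: red_is_term)

lemma reds_App:
  assumes "(red F R)\<^sup>*\<^sup>* s s'" and "(red F R)\<^sup>*\<^sup>* t t'" and "is_term F (App s t)"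
  shows "(red F R)\<^sup>*\<^sup>* (App s t) (App s' t')"
proof -
  have reds_fun: "(red F R)\<^sup>*\<^sup>* (App s t) (App s' t)"
    using assms(1)
  proof (induction rule: rtranclp_induct)
    case (step s' s'')
    then show ?case
      using red_App_fun reds_is_term assms(3) by (meson rtranclp.rtrancl_into_rtrancl)
  qed simp
  have "(red F R)\<^sup>*\<^sup>* (App s' t) (App s' t')"
    using assms(2)
  proof (induction rule: rtranclp_induct)
    case (step t' t'')
    then have "is_term F (App s' t')"
      using reds_is_term reds_fun assms(3) by blast
    with step show ?case
      using red_App_arg by (meson rtranclp.rtrancl_into_rtrancl)
  qed simp
  with reds_fun show ?thesis by (rule rtranclp_trans)
qed

lemma reds_apps:
  "list_all2 (red F R)\<^sup>*\<^sup>* us ws \<Longrightarrow> (red F R)\<^sup>*\<^sup>* h h' \<Longrightarrow> is_term F (apps h us) \<Longrightarrow>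
    (red F R)\<^sup>*\<^sup>* (apps h us) (apps h' ws)"
proof (induction arbitrary: h h' rule: list_all2_induct)
  case (Cons u us w ws)
  then have "(red F R)\<^sup>*\<^sup>* (App h u) (App h' w)"
    using reds_App is_term_apps_head[of F "App h u"] by simp
  then show ?case using Cons.IH Cons.prems(2) by simp
qed simp

text \<open>
  The rules of \<open>red\<close> for applications require the whole application to be a term, so \<open>imm_sub\<close>
  commutes with \<open>red\<close> only when restricted to terms.
\<close>

inductive imm_sub :: "('f, 'v, 'm, 's) mterm \<Rightarrow> ('f, 'v, 'm, 's) mterm \<Rightarrow> bool" where
  App_fun: "is_term F (App s t) \<Longrightarrow> imm_sub (App s t) s"
| App_arg: "is_term F (App s t) \<Longrightarrow> imm_sub (App s t) t"
| lam_body: "is_term F (lam x s) \<Longrightarrow> imm_sub (lam x s) s"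

definition red_sub :: "('f, 'v, 'm, 's) mterm \<Rightarrow> ('f, 'v, 'm, 's) mterm \<Rightarrow> bool" where
  "red_sub = sup (red F R) imm_sub"

lemma imm_sub_is_term: "imm_sub s t \<Longrightarrow> is_term F t"
  by (cases rule: imm_sub.cases) (auto dest: is_term_AppD is_term_lamD)

lemma red_subs_is_term: "red_sub\<^sup>*\<^sup>* s t \<Longrightarrow> is_term F s \<Longrightarrow> is_term F t"
  by (induction rule: rtranclp_induct) (auto simp: red_sub_def dest: red_is_term imm_sub_is_term)

lemma reds_imp_red_subs: "(red F R)\<^sup>*\<^sup>* s t \<Longrightarrow> red_sub\<^sup>*\<^sup>* s t"
  by (rule rtranclp_mono[THEN predicate2D]) (auto simp: red_sub_def)

lemma imm_subs_imp_red_subs: "imm_sub\<^sup>*\<^sup>* s t \<Longrightarrow> red_sub\<^sup>*\<^sup>* s t"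
  by (rule rtranclp_mono[THEN predicate2D]) (auto simp: red_sub_def)

lemma imm_sub_red_commute: "imm_sub OO red F R \<le> red F R OO imm_sub"
proof (rule predicate2I, erule relcomppE)
  fix u s s' assume "imm_sub u s" and red: "red F R s s'"
  then show "(red F R OO imm_sub) u s'"
  proof cases
    case (App_fun t)
    then have "red F R u (App s' t)" using red by (auto intro: red.intros)
    moreover from this have "imm_sub (App s' t) s'"
      using red_is_term App_fun by (blast intro: imm_sub.intros)
    ultimately show ?thesis by blast
  next
    case (App_arg t)
    then have "red F R u (App t s')" using red by (auto intro: red.intros)
    moreover from this have "imm_sub (App t s') s'"
      using red_is_term App_arg by (blast intro: imm_sub.intros)
    ultimately show ?thesis by blast
  next
    case (lam_body x)
    then have "red F R u (lam x s')" using red by (auto intro: red.intros)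
    moreover from this have "imm_sub (lam x s') s'"
      using red_is_term lam_body by (blast intro: imm_sub.intros)
    ultimately show ?thesis by blast
  qed
qed

lemma not_terminating_if_infinite_red_subs:
  assumes "\<And>i. (red F R OO red_sub\<^sup>*\<^sup>*) (a i) (a (Suc i))"
  shows "\<not> terminating F R"
proof -
  have "imm_sub \<le> red_sub\<^sup>*\<^sup>*" by (auto simp: red_sub_def)
  then have "red F R OO imm_sub \<le> red F R OO red_sub\<^sup>*\<^sup>*" by (intro relcompp_mono) auto
  with imm_sub_red_commute have "imm_sub OO red F R \<le> red F R OO red_sub\<^sup>*\<^sup>*" by (rule order_trans)
  then show ?thesis
    using infinite_chain_if_quasi_commute assms unfolding red_sub_def terminating_def by blast
qed

lemma imm_subs_apps_head: "is_term F (apps h ts) \<Longrightarrow> imm_sub\<^sup>*\<^sup>* (apps h ts) h"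
proof (induction ts rule: rev_induct)
  case (snoc t ts)
  then have "imm_sub (apps h (ts @ [t])) (apps h ts)" by (simp add: imm_sub.intros)
  moreover from this have "imm_sub\<^sup>*\<^sup>* (apps h ts) h" using imm_sub_is_term snoc.IH by blast
  ultimately show ?case by (rule converse_rtranclp_into_rtranclp)
qed simp

lemma imm_subs_apps_arg:
  assumes "t \<in> set ts" and "is_term F (apps h ts)"
  shows "imm_sub\<^sup>*\<^sup>* (apps h ts) t"
proof -
  obtain ts\<^sub>1 ts\<^sub>2 where ts: "ts = ts\<^sub>1 @ t # ts\<^sub>2" using assms(1) by (meson split_list)
  let ?app = "App (apps h ts\<^sub>1) t"
  have "apps h ts = apps ?app ts\<^sub>2" by (simp add: ts)
  then have "imm_sub\<^sup>*\<^sup>* (apps h ts) ?app" "is_term F ?app"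
    using imm_subs_apps_head is_term_apps_head assms(2) by metis+
  then show ?thesis using imm_sub.App_arg by (blast intro: rtranclp.rtrancl_into_rtrancl)
qed

section \<open>Instances of \<open>\<beta>\<close>-subterms\<close>

lemma imm_subs_inst_occurs_Bnd:
  "occurs_Bnd m t \<Longrightarrow> m < length ws \<Longrightarrow> is_term F (inst 0 ws t) \<Longrightarrow> imm_sub\<^sup>*\<^sup>* (inst 0 ws t) (ws ! m)"
proof (induction t arbitrary: m ws)
  case (App s t)
  then have "is_term F (inst 0 ws s)" "is_term F (inst 0 ws t)" by (auto dest: is_term_AppD)
  with App have "imm_sub\<^sup>*\<^sup>* (inst 0 ws s) (ws ! m) \<or> imm_sub\<^sup>*\<^sup>* (inst 0 ws t) (ws ! m)" by auto
  moreover have "imm_sub (inst 0 ws (App s t)) (inst 0 ws s)"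
    and "imm_sub (inst 0 ws (App s t)) (inst 0 ws t)"
    using App.prems(3) by (simp_all add: imm_sub.intros)
  ultimately show ?case by (meson converse_rtranclp_into_rtranclp)
next
  case (Abs \<sigma> t)
  obtain y where y: "vty y = \<sigma>" "y \<notin> FV (inst 1 ws t)" by (rule fresh_var)
  have "inst 0 ws (Abs \<sigma> t) = lam y (inst 0 (Free y # ws) t)"
    using y lam_inst_Free[OF y(2)] by (simp add: inst_Cons)
  then have "imm_sub (inst 0 ws (Abs \<sigma> t)) (inst 0 (Free y # ws) t)"
    using Abs.prems(3) by (simp add: imm_sub.intros)
  moreover from this have "imm_sub\<^sup>*\<^sup>* (inst 0 (Free y # ws) t) (ws ! m)"
    using Abs.IH[of "Suc m" "Free y # ws"] Abs.prems(1,2) imm_sub_is_term by simp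
  ultimately show ?case by (rule converse_rtranclp_into_rtranclp)
qed simp_all

lemma imm_subs_meta_app_lams:
  assumes "distinct xs" and "\<not> is_abs t" and "FMV t = {}"
    and occurs: "length xs \<le> i \<or> xs ! i \<in> FV t" and i: "i < length ss"
    and "is_term F (meta_app (lams xs t) ss)"
  shows "imm_sub\<^sup>*\<^sup>* (meta_app (lams xs t) ss) (ss ! i)"
proof -
  obtain n u where strip: "strip_abs (length ss) (lams xs t) = (n, u)" by fastforce
  let ?ws = "rev (take n ss)"
  have meta_app: "meta_app (lams xs t) ss = apps (inst 0 ?ws u) (drop n ss)"
    using strip by (simp add: meta_app_def)
  with assms(6) have is_term: "is_term F (apps (inst 0 ?ws u) (drop n ss))" by simp
  show ?thesis
  proof (cases "i < n")
    case False
    then have "ss ! i \<in> set (drop n ss)"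
      using i nth_mem[of "i - n" "drop n ss"] by simp
    then show ?thesis unfolding meta_app using is_term by (rule imm_subs_apps_arg)
  next
    case True
    have n: "n \<le> length xs" "n \<le> length ss"
      using strip_abs_lams_le assms(2) strip strip_abs_le by blast+
    then have "occurs_Bnd (n - 1 - i) u"
      using occurs_Bnd_strip_abs_lams assms(1,3) occurs strip True by auto
    then have "imm_sub\<^sup>*\<^sup>* (inst 0 ?ws u) (?ws ! (n - 1 - i))"
      using True n is_term_apps_head[OF is_term] by (intro imm_subs_inst_occurs_Bnd) auto
    moreover have "?ws ! (n - 1 - i) = ss ! i" using True n by (simp add: rev_nth)
    ultimately show ?thesis
      unfolding meta_app using imm_subs_apps_head[OF is_term] by simp
  qed
qed

lemma imm_subs_subst_Meta_arg:
  assumes \<gamma>: "is_subst F \<gamma>" "respects_conds \<gamma> A"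
    and i: "(Z, i) \<in> A" "1 \<le> i" "i \<le> length ts"
    and "is_term F (subst \<gamma> (apps (Meta Z ts) ss))"
  shows "imm_sub\<^sup>*\<^sup>* (subst \<gamma> (apps (Meta Z ts) ss)) (subst \<gamma> (ts ! (i - 1)))"
proof -
  let ?head = "subst \<gamma> (Meta Z ts)"
  have is_term: "is_term F (apps ?head (map (subst \<gamma>) ss))"
    using assms(6) by (simp only: subst_apps)
  have head_is_term: "is_term F ?head" using is_term by (rule is_term_apps_head)
  then have Z: "Inr Z \<in> sdom \<gamma>" by (auto simp: is_term_def)
  from \<gamma>(2) i(1) obtain xs v where v: "\<gamma> (Inr Z) = lams xs v" "distinct xs" "\<not> is_abs v"
    and occurs: "i > length xs \<or> 1 \<le> i \<and> i \<le> length xs \<and> xs ! (i - 1) \<in> FV v"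
    unfolding respects_conds_def by blast
  have head: "?head = meta_app (lams xs v) (map (subst \<gamma>) ts)" using Z v(1) by simp
  have "FMV v = {}" using is_subst_FMV[OF \<gamma>(1) Z] v(1) by (simp add: FMV_lams)
  then have "imm_sub\<^sup>*\<^sup>* ?head (map (subst \<gamma>) ts ! (i - 1))"
    using v occurs i head_is_term unfolding head by (intro imm_subs_meta_app_lams) auto
  moreover have "imm_sub\<^sup>*\<^sup>* (subst \<gamma> (apps (Meta Z ts) ss)) ?head"
    using imm_subs_apps_head[OF is_term] by (simp only: subst_apps)
  ultimately show ?thesis using i by simp
qed

lemma reds_subst_beta:
  assumes \<gamma>: "lc_subst \<gamma>" and is_term: "is_term F (subst \<gamma> (apps (lam x u) (s # ss)))"
  shows "(red F R)\<^sup>*\<^sup>* (subst \<gamma> (apps (lam x u) (s # ss))) (subst \<gamma> (apps (subst1 x s u) ss))"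
proof -
  obtain y where lam: "subst \<gamma> (lam x u) = lam y (subst (\<gamma>(Inl x := Free y)) u)"
    and inst: "\<And>w. lc_at 0 w \<Longrightarrow> subst1 y w (subst (\<gamma>(Inl x := Free y)) u) = subst (\<gamma>(Inl x := w)) u"
    using subst_lam[OF \<gamma>] by metis
  let ?redex = "App (subst \<gamma> (lam x u)) (subst \<gamma> s)"
  have is_term_redex: "is_term F (apps ?redex (map (subst \<gamma>) ss))"
    using is_term by (simp add: subst_apps)
  then have redex: "is_term F ?redex" by (rule is_term_apps_head)
  then have "lc_at 0 (subst \<gamma> s)" using is_term_AppD is_term_imp_lc by blast
  then have "red F R ?redex (subst \<gamma> (subst1 x s u))"
    using red_beta redex inst unfolding lam subst_subst1 by metis
  then have "(red F R)\<^sup>*\<^sup>* (apps ?redex (map (subst \<gamma>) ss))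
      (apps (subst \<gamma> (subst1 x s u)) (map (subst \<gamma>) ss))"
    using is_term_redex by (intro reds_apps) (auto simp: list_all2_refl)
  then show ?thesis by (simp add: subst_apps)
qed

text \<open>
  Passing below an abstraction may rename the bound variable, so only the values of the
  meta-variables persist in the target instance.
\<close>

definition reaches_instance ::
  "('f, 'v, 'm, 's) subst \<Rightarrow> ('f, 'v, 'm, 's) mterm \<Rightarrow> ('f, 'v, 'm, 's) mterm \<Rightarrow> bool" where
  "reaches_instance \<gamma> s t \<longleftrightarrow>
    (\<exists>\<gamma>'. \<gamma>' \<circ> Inr = \<gamma> \<circ> Inr \<and> red_sub\<^sup>*\<^sup>* (subst \<gamma> s) (subst \<gamma>' t))"

lemma reaches_instance_trans:
  assumes "red_sub\<^sup>*\<^sup>* (subst \<gamma> s) (subst \<gamma>' u)" and "\<gamma>' \<circ> Inr = \<gamma> \<circ> Inr"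
    and "reaches_instance \<gamma>' u t"
  shows "reaches_instance \<gamma> s t"
  using assms unfolding reaches_instance_def by (metis rtranclp_trans)

lemma reaches_instance_apps_arg:
  assumes "s \<in> set ss" and "is_term F (subst \<gamma> (apps h ss))"
    and "is_term F (subst \<gamma> s) \<Longrightarrow> reaches_instance \<gamma> s t"
  shows "reaches_instance \<gamma> (apps h ss) t"
proof -
  have "imm_sub\<^sup>*\<^sup>* (subst \<gamma> (apps h ss)) (subst \<gamma> s)"
    using assms(1,2) by (auto simp: subst_apps intro: imm_subs_apps_arg)
  then have "red_sub\<^sup>*\<^sup>* (subst \<gamma> (apps h ss)) (subst \<gamma> s)" by (rule imm_subs_imp_red_subs)
  then show ?thesis using red_subs_is_term assms(2,3) reaches_instance_trans by blast
qed

lemma red_sub_subst_lam: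
  assumes "is_subst F \<gamma>" and "is_term F (subst \<gamma> (lam x u))"
  obtains y where "is_subst F (\<gamma>(Inl x := Free y))"
    and "red_sub (subst \<gamma> (lam x u)) (subst (\<gamma>(Inl x := Free y)) u)"
proof -
  obtain y where y: "vty y = vty x"
    and lam: "subst \<gamma> (lam x u) = lam y (subst (\<gamma>(Inl x := Free y)) u)"
    using subst_lam[OF is_subst_imp_lc_subst[OF assms(1)]] by metis
  have "imm_sub (subst \<gamma> (lam x u)) (subst (\<gamma>(Inl x := Free y)) u)"
    using assms(2) unfolding lam by (rule imm_sub.lam_body)
  then have "red_sub (subst \<gamma> (lam x u)) (subst (\<gamma>(Inl x := Free y)) u)" by (simp add: red_sub_def)
  moreover have "is_subst F (\<gamma>(Inl x := Free y))"
    using has_type_Free[of F "[]" y] y by (intro is_subst_upd assms(1)) simp_all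
  ultimately show ?thesis using that by blast
qed

lemmas beta_sub_induct
  [consumes 1, case_names refl lam redex_arg beta Fn_arg Free_arg Meta_arg cond_arg]
  = beta_sub.induct

lemma beta_sub_imp_reaches_instance:
  assumes "beta_sub A s t" and "is_subst F \<gamma>" and "respects_conds \<gamma> A" and "is_term F (subst \<gamma> s)"
  shows "reaches_instance \<gamma> s t"
  using assms
proof (induction arbitrary: \<gamma> rule: beta_sub_induct)
  case refl
  then show ?case by (auto simp: reaches_instance_def)
next
  case (lam u t x)
  from lam.prems(1,3) obtain y where subst: "is_subst F (\<gamma>(Inl x := Free y))"
    and step: "red_sub (subst \<gamma> (lam x u)) (subst (\<gamma>(Inl x := Free y)) u)"
    by (rule red_sub_subst_lam)
  have metas: "\<gamma>(Inl x := Free y) \<circ> Inr = \<gamma> \<circ> Inr" by (auto simp: fun_eq_iff)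
  have "respects_conds (\<gamma>(Inl x := Free y)) A" using lam.prems(2) by (simp add: respects_conds_def)
  then show ?case
    using lam.IH[OF subst] red_subs_is_term lam.prems(3) step metas reaches_instance_trans by blast
next
  case (beta x s u ss t)
  have "red_sub\<^sup>*\<^sup>* (subst \<gamma> (apps (lam x u) (s # ss))) (subst \<gamma> (apps (subst1 x s u) ss))"
    using is_subst_imp_lc_subst[OF beta.prems(1)] beta.prems(3)
    by (intro reds_imp_red_subs reds_subst_beta)
  then show ?case using beta.IH beta.prems red_subs_is_term reaches_instance_trans by blast
next
  case (cond_arg Z i ts t ss)
  have "imm_sub\<^sup>*\<^sup>* (subst \<gamma> (apps (Meta Z ts) ss)) (subst \<gamma> (ts ! (i - 1)))"
    using cond_arg by (intro imm_subs_subst_Meta_arg)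
  then have "red_sub\<^sup>*\<^sup>* (subst \<gamma> (apps (Meta Z ts) ss)) (subst \<gamma> (ts ! (i - 1)))"
    by (rule imm_subs_imp_red_subs)
  then show ?case using cond_arg.IH cond_arg.prems red_subs_is_term reaches_instance_trans by blast
qed (blast intro: reaches_instance_apps_arg)+

end

section \<open>Relabelling function symbols\<close>

definition relabel :: "('f \<Rightarrow> 'g) \<Rightarrow> ('f, 'v, 'm, 's) mterm \<Rightarrow> ('g, 'v, 'm, 's) mterm" where
  "relabel h = map_mterm h id id id"

lemma relabel_simps [simp]:
  "relabel h (Free x) = Free x"
  "relabel h (Bnd i) = Bnd i"
  "relabel h (Fn f) = Fn (h f)"
  "relabel h (App s t) = App (relabel h s) (relabel h t)"
  "relabel h (Abs \<sigma> t) = Abs \<sigma> (relabel h t)"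
  "relabel h (Meta Z ts) = Meta Z (map (relabel h) ts)"
  by (simp_all add: relabel_def ty.map_id)

lemma relabel_eq_Free_iff [simp]: "relabel h t = Free x \<longleftrightarrow> t = Free x"
  by (cases t) auto

lemma relabel_eq_Bnd_iff [simp]: "relabel h t = Bnd i \<longleftrightarrow> t = Bnd i"
  by (cases t) auto

lemma FV_relabel [simp]: "FV (relabel h t) = FV t"
  by (simp add: relabel_def mterm.set_map)

lemma FMV_relabel [simp]: "FMV (relabel h t) = FMV t"
  by (simp add: relabel_def mterm.set_map)

lemma is_abs_relabel [simp]: "is_abs (relabel h t) = is_abs t"
  by (cases t) auto

lemma relabel_apps: "relabel h (apps s ts) = apps (relabel h s) (map (relabel h) ts)"
  by (induction ts arbitrary: s) auto

lemma relabel_foldr_Abs: "relabel h (foldr Abs \<sigma>s t) = foldr Abs \<sigma>s (relabel h t)"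
  by (induction \<sigma>s) auto

lemma relabel_shift: "relabel h (shift d c t) = shift d c (relabel h t)"
  by (induction t arbitrary: c) auto

lemma relabel_inst: "relabel h (inst c ws t) = inst c (map (relabel h) ws) (relabel h t)"
  by (induction t arbitrary: c) (auto simp: relabel_shift)

lemma relabel_bind: "relabel h (bind c x t) = bind c x (relabel h t)"
  by (induction t arbitrary: c) auto

lemma strip_abs_relabel: "strip_abs k (relabel h t) = map_prod id (relabel h) (strip_abs k t)"
  by (induction k t rule: strip_abs.induct) (auto split: prod.splits)

lemma relabel_meta_app: "relabel h (meta_app v ss) = meta_app (relabel h v) (map (relabel h) ss)"
  by (auto simp: meta_app_def strip_abs_relabel relabel_apps relabel_inst rev_map take_map drop_map
    split: prod.splits)

context symbols
begin

lemma relabel_lam: "relabel h (lam x t) = lam x (relabel h t)"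
  by (simp add: lam_def relabel_bind)

lemma relabel_lams: "relabel h (lams xs t) = lams xs (relabel h t)"
  by (induction xs) (simp_all add: relabel_lam)

lemma relabel_meta_id: "relabel h (meta_id Z) = meta_id Z"
  by (simp add: meta_id_def relabel_foldr_Abs o_def)

lemma relabel_eq_meta_id_iff: "relabel h t = meta_id Z \<longleftrightarrow> t = meta_id Z"
proof -
  have args: "map (relabel h) ts = map Bnd js \<longleftrightarrow> ts = map Bnd js" for ts js
    by (auto simp: list_eq_iff_nth_eq)
  have "relabel h t = foldr Abs \<sigma>s (Meta Z (map Bnd js)) \<longleftrightarrow> t = foldr Abs \<sigma>s (Meta Z (map Bnd js))"
    for \<sigma>s js
  proof (induction \<sigma>s arbitrary: t)
    case Nil
    then show ?case by (cases t) (simp_all add: args)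
  next
    case (Cons \<sigma> \<sigma>s)
    then show ?case by (cases t) auto
  qed
  then show ?thesis by (simp add: meta_id_def)
qed

lemma relabel_subst: "relabel h (subst \<gamma> t) = subst (relabel h \<circ> \<gamma>) (relabel h t)"
  by (induction t) (auto simp: relabel_eq_meta_id_iff relabel_meta_app o_def cong: map_cong)

lemma relabel_subst1: "relabel h (subst1 x t s) = subst1 x (relabel h t) (relabel h s)"
proof -
  have "relabel h \<circ> var_subst (Free(x := t)) = var_subst (Free(x := relabel h t))"
    by (auto simp: fun_eq_iff var_subst_def relabel_meta_id split: sum.splits)
  then show ?thesis by (simp add: subst1_def relabel_subst)
qed

lemma sdom_relabel: "sdom (relabel h \<circ> \<gamma>) = sdom \<gamma>"
  by (simp add: sdom_def relabel_eq_meta_id_iff)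

lemma respects_conds_relabel:
  assumes "respects_conds \<gamma> A"
  shows "respects_conds (relabel h \<circ> \<gamma>) A"
  unfolding respects_conds_def
proof (intro ballI, clarify)
  fix Z i assume "(Z, i) \<in> A"
  with assms obtain xs t where "\<gamma> (Inr Z) = lams xs t" "distinct xs" "\<not> is_abs t"
    and "i > length xs \<or> 1 \<le> i \<and> i \<le> length xs \<and> xs ! (i - 1) \<in> FV t"
    unfolding respects_conds_def by blast
  then show "\<exists>xs t. (relabel h \<circ> \<gamma>) (Inr Z) = lams xs t \<and> distinct xs \<and> \<not> is_abs t \<and>
    (i > length xs \<or> 1 \<le> i \<and> i \<le> length xs \<and> xs ! (i - 1) \<in> FV t)"
    by (intro exI[of _ xs] exI[of _ "relabel h t"]) (simp add: relabel_lams)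
qed

lemma has_type_relabel:
  assumes "F \<subseteq>\<^sub>m G \<circ> h"
  shows "has_type F \<Gamma> t \<sigma> \<Longrightarrow> has_type G \<Gamma> (relabel h t) \<sigma>"
proof (induction rule: has_type_induct)
  case (Meta ss Z \<sigma>s \<tau> \<Gamma>)
  then show ?case by (auto intro!: has_type_Meta_mapI elim: list_all2_mono)
next
  case (Fn f \<sigma> \<Gamma>)
  then show ?case using assms by (force simp: map_le_def intro: has_type.intros)
qed (auto intro: has_type.intros)

lemma is_term_relabel:
  assumes "F \<subseteq>\<^sub>m G \<circ> h"
  shows "is_term F t \<Longrightarrow> is_term G (relabel h t)"
  using has_type_relabel[OF assms] by (fastforce simp: is_term_def is_mterm_def)

lemma is_subst_relabel:
  assumes "F \<subseteq>\<^sub>m G \<circ> h"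
  shows "is_subst F \<gamma> \<Longrightarrow> is_subst G (relabel h \<circ> \<gamma>)"
  using has_type_relabel[OF assms] is_term_relabel[OF assms]
  by (simp add: is_subst_def sdom_relabel)

lemma red_relabel:
  assumes sig: "F \<subseteq>\<^sub>m G \<circ> h"
    and rules: "\<And>l r. (l, r) \<in> R \<Longrightarrow> (relabel h l, relabel h r) \<in> S"
  shows "red F R s s' \<Longrightarrow> red G S (relabel h s) (relabel h s')"
proof (induction rule: red_induct)
  case (root l r \<delta>)
  then show ?case
    unfolding relabel_subst
    by (intro red_root) (simp_all add: rules is_subst_relabel[OF sig] sdom_relabel)
next
  case (beta x s t)
  then show ?case
    using is_term_relabel[OF sig beta] by (simp add: relabel_lam relabel_subst1 red_beta)
next
  case (App_fun s s' t)
  then show ?case using is_term_relabel[OF sig App_fun.hyps(2)] by (simp add: red_App_fun)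
next
  case (App_arg t t' s)
  then show ?case using is_term_relabel[OF sig App_arg.hyps(2)] by (simp add: red_App_arg)
next
  case (lam s s' x)
  then show ?case by (simp add: relabel_lam red_lam)
qed

end

section \<open>Erasing marks\<close>

fun unmark_sym :: "'f marked \<Rightarrow> 'f" where
  "unmark_sym (Plain f) = f"
| "unmark_sym (Sharp f) = f"

abbreviation unmark :: "('f marked, 'v, 'm, 's) mterm \<Rightarrow> ('f, 'v, 'm, 's) mterm" where
  "unmark \<equiv> relabel unmark_sym"

lemma unmark_plain [simp]: "unmark (plain t) = t"
  by (simp add: relabel_def plain_def mterm.map_comp o_def mterm.map_ident)

lemma unmark_plain_rules: "(l, r) \<in> plain_rules R \<Longrightarrow> (unmark l, unmark r) \<in> R"
  by (auto simp: plain_rules_def)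

lemma sharp_sig_map_le: "sharp_sig F R \<subseteq>\<^sub>m F \<circ> unmark_sym"
  unfolding map_le_def
proof
  fix f assume "f \<in> dom (sharp_sig F R)"
  then show "sharp_sig F R f = (F \<circ> unmark_sym) f" by (cases f) (auto split: if_splits)
qed

context symbols
begin

lemmas is_term_unmark = is_term_relabel[OF sharp_sig_map_le]
lemmas is_subst_unmark = is_subst_relabel[OF sharp_sig_map_le]

lemma reds_unmark:
  "(red (sharp_sig F R) (plain_rules R))\<^sup>*\<^sup>* s s' \<Longrightarrow> (red F R)\<^sup>*\<^sup>* (unmark s) (unmark s')"
proof (induction rule: rtranclp_induct)
  case (step s' s'')
  then have "red F R (unmark s') (unmark s'')"
    using red_relabel[OF sharp_sig_map_le unmark_plain_rules] by blast
  with step.IH show ?case by (rule rtranclp.rtrancl_into_rtrancl)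
qed simp

lemma unmark_sharp: "is_sharp R minar s s' \<Longrightarrow> unmark s' = s"
  by (auto simp: is_sharp_def relabel_apps o_def)

section \<open>Conservative chains\<close>

lemma is_metafy_trivial:
  assumes "is_metafy M s s'" and "FMV s' \<subseteq> M"
  shows "FV s = {}" and "s' = s"
proof -
  obtain \<xi> where fresh: "\<And>x. x \<in> FV s \<Longrightarrow> \<xi> x \<notin> M"
    and s': "s' = subst (var_subst (\<lambda>x. if x \<in> FV s then Meta (\<xi> x) [] else Free x)) s"
    using assms(1) unfolding is_metafy_def by blast
  have "\<xi> x \<in> M" if "x \<in> FV s" for x
    using FMV_subst_var_subst[OF that, of "\<lambda>x. if x \<in> FV s then Meta (\<xi> x) [] else Free x"]
      assms(2) that by (auto simp: s')
  then show "FV s = {}" using fresh by blast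
  then show "s' = s" using s' by simp
qed

lemma conservative_SDPE:
  assumes "(l, p, A) \<in> SDP R minar" and "conservative (l, p, A)"
  obtains r where "(unmark l, r) \<in> R" "(unmark p, A) \<in> cand R minar r" "FV p = {}"
proof -
  obtain r q q' where r: "(unmark l, r) \<in> R" "(q, A) \<in> cand R minar r"
    and sharp: "is_sharp R minar q q'" and metafy: "is_metafy (FMV l \<union> FMV q' \<union> fst ` A) q' p"
    using assms(1) unfolding SDP_def by (auto dest: unmark_sharp)
  have "FMV p \<subseteq> FMV l \<union> FMV q' \<union> fst ` A"
    using assms(2) by (auto simp: conservative_def)
  with metafy have "FV q' = {}" "p = q'" by (rule is_metafy_trivial)+
  then show ?thesis using that r unmark_sharp[OF sharp] by simp
qed

end

context afsm_system
begin

lemma rule_to_cand_red_subs: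
  assumes lr: "(l, r) \<in> R" and p: "(p, A) \<in> cand R minar r" "FV p = {}"
    and \<gamma>: "is_subst F \<gamma>" "sdom \<gamma> = Inr ` FMV l" "respects_conds \<gamma> A"
    and is_term: "is_term F (subst \<gamma> l)"
  shows "(red F R OO red_sub\<^sup>*\<^sup>*) (subst \<gamma> l) (subst \<gamma> p)"
proof -
  have red: "red F R (subst \<gamma> l) (subst \<gamma> r)" using lr \<gamma>(1,2) by (rule red_root)
  then have "is_term F (subst \<gamma> r)" using is_term by (rule red_is_term)
  moreover obtain us where "beta_sub A r (apps p us)" using p(1) unfolding cand_def by blast
  ultimately obtain \<gamma>' where \<gamma>': "\<gamma>' \<circ> Inr = \<gamma> \<circ> Inr"
    and reach: "red_sub\<^sup>*\<^sup>* (subst \<gamma> r) (subst \<gamma>' (apps p us))"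
    using beta_sub_imp_reaches_instance \<gamma>(1,3) unfolding reaches_instance_def by blast
  have "is_term F (subst \<gamma>' (apps p us))"
    using reach \<open>is_term F (subst \<gamma> r)\<close> by (rule red_subs_is_term)
  then have "red_sub\<^sup>*\<^sup>* (subst \<gamma>' (apps p us)) (subst \<gamma>' p)"
    unfolding subst_apps by (intro imm_subs_imp_red_subs imm_subs_apps_head)
  moreover have "subst \<gamma>' p = subst \<gamma> p" using \<gamma>' by (rule subst_cong) (simp add: p(2))
  ultimately show ?thesis using red reach by (metis relcomppI rtranclp_trans)
qed

lemma conservative_SDP_red_subs:
  assumes dp: "(l, p, A) \<in> SDP R minar" "conservative (l, p, A)"
    and \<gamma>: "is_subst (sharp_sig F R) \<gamma>" "sdom \<gamma> = Inr ` (FMV l \<union> FMV p)" "respects_conds \<gamma> A"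
    and is_term: "is_term (sharp_sig F R) (subst \<gamma> l)"
  shows "(red F R OO red_sub\<^sup>*\<^sup>*) (unmark (subst \<gamma> l)) (unmark (subst \<gamma> p))"
proof -
  obtain r where "(unmark l, r) \<in> R" "(unmark p, A) \<in> cand R minar r" "FV p = {}"
    using dp by (rule conservative_SDPE)
  moreover have "FMV l \<union> FMV p = FMV l" using dp(2) by (auto simp: conservative_def)
  ultimately show ?thesis
    unfolding relabel_subst
    using is_subst_unmark[OF \<gamma>(1)] \<gamma>(2) respects_conds_relabel[OF \<gamma>(3)] is_term_unmark[OF is_term]
    by (intro rule_to_cand_red_subs) (simp_all add: sdom_relabel relabel_subst)
qed

lemma reds_unmark_apps:
  assumes "list_all2 (red (sharp_sig F R) (plain_rules R))\<^sup>*\<^sup>* us ws"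
    and "is_term (sharp_sig F R) (apps h us)"
  shows "(red F R)\<^sup>*\<^sup>* (unmark (apps h us)) (unmark (apps h ws))"
proof -
  have "list_all2 (red F R)\<^sup>*\<^sup>* (map unmark us) (map unmark ws)"
    unfolding list_all2_map1 list_all2_map2 using assms(1)
    by (rule list_all2_mono) (rule reds_unmark)
  moreover have "is_term F (apps (unmark h) (map unmark us))"
    using is_term_unmark[OF assms(2)] by (simp add: relabel_apps)
  ultimately show ?thesis unfolding relabel_apps by (intro reds_apps) simp_all
qed

lemma conservative_chain_red_subs:
  assumes chain: "infinite_chain (sharp_sig F R) (SDP R minar) (plain_rules R)
      (\<lambda>i. (\<rho> i, s i, t i))"
    and conservative: "conservative (\<rho> i)"
  shows "(red F R OO red_sub\<^sup>*\<^sup>*) (unmark (s i)) (unmark (s (Suc i)))"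
proof -
  obtain l p A where \<rho>: "\<rho> i = (l, p, A)" by (cases "\<rho> i") auto
  from spec[OF chain[unfolded infinite_chain_def], of i]
  obtain \<gamma> f us ws where dp: "(l, p, A) \<in> SDP R minar"
    and is_term: "is_term (sharp_sig F R) (s i)" "is_term (sharp_sig F R) (t i)"
    and \<gamma>: "is_subst (sharp_sig F R) \<gamma>" "sdom \<gamma> = Inr ` (FMV l \<union> FMV p)" "respects_conds \<gamma> A"
    and st: "s i = subst \<gamma> l" "t i = subst \<gamma> p"
    and args: "t i = apps (Fn f) us" "s (Suc i) = apps (Fn f) ws"
      "list_all2 (red (sharp_sig F R) (plain_rules R))\<^sup>*\<^sup>* us ws"
    unfolding \<rho> prod.case fst_conv snd_conv by blast
  have "(red F R OO red_sub\<^sup>*\<^sup>*) (unmark (s i)) (unmark (t i))"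
    using conservative_SDP_red_subs[OF dp _ \<gamma>] conservative is_term(1) unfolding \<rho> st by blast
  moreover have "red_sub\<^sup>*\<^sup>* (unmark (t i)) (unmark (s (Suc i)))"
    using reds_unmark_apps[OF args(3)] is_term(2) unfolding args(1,2)
    by (blast intro: reds_imp_red_subs)
  ultimately show ?thesis by (auto intro: rtranclp_trans)
qed

end

theorem theorem34:
  fixes vty :: "'v \<Rightarrow> 's ty"
    and mty :: "'m \<Rightarrow> 's ty"
    and arity :: "'m \<Rightarrow> nat"
    and F :: "('f, 's) sig"
    and R :: "('f, 'v, 'm, 's) rule set"
    and minar :: "'f \<Rightarrow> nat"
    and \<rho> :: "nat \<Rightarrow> ('f marked, 'v, 'm, 's) dp"
    and s t :: "nat \<Rightarrow> ('f marked, 'v, 'm, 's) mterm"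
  assumes "symbols vty mty arity"
    and "symbols.afsm vty mty arity F R"
    and "symbols.infinite_chain vty mty arity (sharp_sig F R) (symbols.SDP vty mty arity R minar)
      (plain_rules R) (\<lambda>i. (\<rho> i, s i, t i))"
    and "\<forall>i. conservative (\<rho> i)"
  shows "\<not> symbols.terminating vty mty arity F R"
proof -
  interpret afsm_system vty mty arity F R
    using assms(1,2) by (intro afsm_system.intro afsm_system_axioms.intro)
  have "(red F R OO red_sub\<^sup>*\<^sup>*) (unmark (s i)) (unmark (s (Suc i)))" for i
    using assms(3,4) conservative_chain_red_subs by blast
  then show "\<not> terminating F R" by (rule not_terminating_if_infinite_red_subs)
qed

end
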